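(* Let $q\ge0$ and let $W^{(q)}$ be the $q$-scale function of the spectrally negative compound Poisson process $L_t=ct-\sum_{i=1}^{N_t}\xi_i$ with drift $c>0$, intensity $\lambda>0$ and jump distribution $\Pi$. Then $$\partial_{+}W^{(q)}(x)=\frac{e^{-q}}{c^2}\,\mathbb{E}^x\!\left[e^{\frac{q+\lambda}{c}L_1}\left(1-\frac{L_1}{c}\right)^{N_1-1}\left((q+\lambda)\left(1-\frac{L_1}{c}\right)-N_1\right)\mathbf{1}_{\{L_1\ge c\}}\right],\quad x\ge0,$$ $$\partial_{-}W^{(q)}(x)=\frac{e^{-q}}{c^2}\,\mathbb{E}^x\!\left[e^{\frac{q+\lambda}{c}L_1}\left(1-\frac{L_1}{c}\right)^{N_1-1}\left((q+\lambda)\left(1-\frac{L_1}{c}\right)-N_1\right)\mathbf{1}_{\{L_1> c\}}\right],\quad x>0,$$ $$\int_0^xW^{(q)}(y)\,\mathrm{d}y=e^{\lambda}\,\mathbb{E}^x\!\left[\int_0^{\frac{L_1}{c}-1}e^{(q+\lambda)y}(-y)^{N_1}\,\mathrm{d}y\;\mathbf{1}_{\{L_1>c\}}\right],\quad x\ge0.$$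
   Context: $(N_t)_{t\ge0}$ is a Poisson process with intensity $\lambda>0$, and $(\xi_i)_{i\ge1}$ are i.i.d., independent of $(N_t)$, with law $\Pi$, a probability measure on $(0,\infty)$. $\mathbb{E}^x$ is expectation for the process started at $x$, i.e. under $\mathbb{P}^x$ one has $L_t=x+ct-\sum_{i=1}^{N_t}\xi_i$; $\mathbb{P}=\mathbb{P}^0$. The Laplace exponent is $\psi(u)=\log\mathbb{E}[e^{uL_1}]=cu+\lambda\int_{(0,\infty)}(e^{-ux}-1)\,\Pi(\mathrm{d}x)$, $u\ge0$. For $q\ge0$ put $\Phi(q)=\sup\{y\ge0:\psi(y)=q\}$; the $q$-scale function $W^{(q)}:[0,\infty)\to\mathbb{R}$ is the unique continuous function with $\int_0^\infty e^{-\beta x}W^{(q)}(x)\,\mathrm{d}x=\frac1{\psi(\beta)-q}$ for all $\beta>\Phi(q)$. $\partial_\pm$ denote right/left derivatives. Conventions: $0^0=1$, and on $\{N_1=0\}$ the product $\left(1-\frac{L_1}{c}\right)^{N_1-1}\left((q+\lambda)\left(1-\frac{L_1}{c}\right)-N_1\right)$ is read as $q+\lambda$. *)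

theory Defs
  imports "HOL-Probability.Probability"
begin

text \<open>
  Time is real and only the times in \<open>{0..}\<close> matter. Path properties are required almost
  surely. Since the paths are almost surely nondecreasing, the truncated subtraction on \<^typ>\<open>nat\<close>
  agrees almost surely with the true increments.
\<close>

definition poisson_process :: "'a measure \<Rightarrow> real \<Rightarrow> (real \<Rightarrow> 'a \<Rightarrow> nat) \<Rightarrow> bool" where
  "poisson_process M lam N \<longleftrightarrow>
     prob_space M \<and>
     (\<forall>t\<ge>0. N t \<in> measurable M (count_space UNIV)) \<and>
     (AE \<omega> in M. N 0 \<omega> = 0 \<and> mono_on {0..} (\<lambda>t. N t \<omega>) \<and>
        (\<forall>t\<ge>0. continuous (at_right t) (\<lambda>s. N s \<omega>))) \<and>
     (\<forall>(n::nat) (t::nat \<Rightarrow> real). 0 \<le> t 0 \<longrightarrow> (\<forall>i<n. t i < t (Suc i)) \<longrightarrow>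
        prob_space.indep_vars M (\<lambda>_. count_space UNIV)
          (\<lambda>i \<omega>. N (t (Suc i)) \<omega> - N (t i) \<omega>) {..<n}) \<and>
     (\<forall>s t. 0 \<le> s \<longrightarrow> s < t \<longrightarrow>
        distr M (count_space UNIV) (\<lambda>\<omega>. N t \<omega> - N s \<omega>)
          = measure_pmf (poisson_pmf (lam * (t - s))))"

text \<open>
  The \<open>\<sigma>\<close>-algebra on \<open>space M\<close> generated by the family \<open>(X i)\<close> with \<open>i \<in> I\<close>. It is needed because
  \<^const>\<open>prob_space.indep_var\<close> forces both random variables to have the same type, which the
  two families \<open>N\<close> and \<open>xi\<close> do not.
\<close>

definition family_events ::
    "'a measure \<Rightarrow> 'i set \<Rightarrow> 'b measure \<Rightarrow> ('i \<Rightarrow> 'a \<Rightarrow> 'b) \<Rightarrow> 'a set set" where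
  "family_events M I S X =
     sets (vimage_algebra (space M) (\<lambda>\<omega>. \<lambda>i\<in>I. X i \<omega>) (PiM I (\<lambda>_. S)))"

text \<open>
  The process \<open>L\<close> with starting point \<open>x\<close>. The law of \<open>(L, N)\<close> under \<open>\<P>\<^sup>x\<close> is the
  law under \<open>M\<close> of \<open>(cpp_path c N xi x, N)\<close>, so \<open>\<E>\<^sup>x\<close> is rendered as the integral with
  respect to \<open>M\<close> with \<open>L\<close> started at \<open>x\<close>.
\<close>

definition cpp_path ::
    "real \<Rightarrow> (real \<Rightarrow> 'a \<Rightarrow> nat) \<Rightarrow> (nat \<Rightarrow> 'a \<Rightarrow> real) \<Rightarrow> real \<Rightarrow> real \<Rightarrow> 'a \<Rightarrow> real" where
  "cpp_path c N xi x t \<omega> = x + c * t - (\<Sum>i = 1..N t \<omega>. xi i \<omega>)"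

definition laplace_exponent ::
    "'a measure \<Rightarrow> real \<Rightarrow> (real \<Rightarrow> 'a \<Rightarrow> nat) \<Rightarrow> (nat \<Rightarrow> 'a \<Rightarrow> real) \<Rightarrow> real \<Rightarrow> real" where
  "laplace_exponent M c N xi u = ln (\<integral>\<omega>. exp (u * cpp_path c N xi 0 1 \<omega>) \<partial>M)"

definition right_inverse :: "(real \<Rightarrow> real) \<Rightarrow> real \<Rightarrow> real" where
  "right_inverse \<psi> q = Sup {y. 0 \<le> y \<and> \<psi> y = q}"

text \<open>
  The defining property of the \<open>q\<close>-scale function. It determines \<open>W\<close> on \<open>{0..}\<close>; the values of
  \<open>W\<close> on the negative half-line are irrelevant and left unconstrained.
\<close>

definition is_scale_function :: "(real \<Rightarrow> real) \<Rightarrow> real \<Rightarrow> (real \<Rightarrow> real) \<Rightarrow> bool" where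
  "is_scale_function \<psi> q W \<longleftrightarrow>
     continuous_on {0..} W \<and>
     (\<forall>\<beta>>right_inverse \<psi> q.
        set_integrable lborel {0..} (\<lambda>x. exp (- \<beta> * x) * W x) \<and>
        (LINT x:{0..}|lborel. exp (- \<beta> * x) * W x) = 1 / (\<psi> \<beta> - q))"

text \<open>
  The integrand of the two derivative formulas without the indicator, as a function of the values
  \<open>l\<close> of \<open>L\<^sub>1\<close> and \<open>n\<close> of \<open>N\<^sub>1\<close>. For \<open>n = 0\<close> the exponent \<open>n - 1\<close> is \<open>-1\<close>, and the product of
  the last two factors is read as \<open>q + lam\<close>. For \<open>n = 1\<close> and \<open>l = c\<close> it uses \<open>0 ^ 0 = 1\<close>.
\<close>

definition deriv_integrand :: "real \<Rightarrow> real \<Rightarrow> real \<Rightarrow> real \<Rightarrow> nat \<Rightarrow> real" where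
  "deriv_integrand c lam q l n =
     exp ((q + lam) / c * l) *
     (if n = 0 then q + lam
      else (1 - l / c) ^ (n - 1) * ((q + lam) * (1 - l / c) - real n))"

end

theory Submission
  imports Defs
begin

text \<open>
  With \<open>S\<close> the sum of the jumps up to time one and \<open>a = q + lam\<close>, expanding
  \<open>1 / (\<psi> \<beta> - q) = 1 / (c \<beta> - a + lam \<integral> exp (- \<beta> x) Pi(dx))\<close> as a geometric series and inverting each term
  gives \<open>W x = exp lam / c \<cdot> E [(- (x - S) / c) ^ N\<^sub>1 exp (a (x - S) / c); S \<le> x]\<close>, the series weights being
  \<open>exp lam\<close> times the Poisson weights of \<open>N\<^sub>1\<close>. Differentiating and integrating in \<open>x\<close> under the expectation
  yields the three formulas; the one-sided derivatives differ only through paths with one jump of size \<open>x\<close>.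
  That \<open>W\<close> is this expectation is Lerch's uniqueness theorem: in the variable \<open>exp (- x)\<close> the Laplace
  transform at \<open>\<beta>\<^sub>0, \<beta>\<^sub>0 + 1, \<dots>\<close> gives all moments, and polynomials are dense.
\<close>

section \<open>Uniqueness of Laplace transforms\<close>

text \<open>The functional taking \<open>\<phi>\<close> to the integral of
  \<open>h x * \<phi> (exp (- x))\<close> vanishes on monomials, hence on polynomials. It is bounded
  by the sup norm of \<open>\<phi>\<close> on [0,1] times the L1 norm of \<open>h\<close>, so by
  Weierstrass approximation it vanishes on all continuous functions.\<close>

lemma exp_moments_eq_0_imp_integral_eq_0:
  fixes h :: "real \<Rightarrow> real" and \<phi> :: "real \<Rightarrow> real"
  assumes int: "set_integrable lborel {0..} h"
    and mom: "\<And>n. (LINT x:{0..}|lborel. h x * exp (- x) ^ n) = 0"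
    and cont: "continuous_on {0..1} \<phi>"
  shows "set_integrable lborel {0..} (\<lambda>x. h x * \<phi> (exp (- x)))"
    and "(LINT x:{0..}|lborel. h x * \<phi> (exp (- x))) = 0"
proof -
  have exp_cont: "continuous_on {0..} (\<lambda>x. \<psi> (exp (- x)))" if "continuous_on {0..1} \<psi>" for \<psi> :: "real \<Rightarrow> real"
    by (rule continuous_on_compose2[OF that]) (auto intro!: continuous_intros)
  have meas: "set_borel_measurable lborel {0..} (\<lambda>x. h x * \<psi> (exp (- x)))"
    if "continuous_on {0..1} \<psi>" for \<psi> :: "real \<Rightarrow> real"
  proof -
    have "set_borel_measurable borel {0..} (\<lambda>x. \<psi> (exp (- x)))"
      unfolding set_borel_measurable_def
      by (rule borel_measurable_continuous_on_indicator) (auto intro!: exp_cont that)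
    moreover have "(\<lambda>x. indicator {0..} x *\<^sub>R h x) \<in> borel_measurable lborel"
      using int unfolding set_integrable_def by (rule borel_measurable_integrable)
    ultimately have "(\<lambda>x. (indicator {0..} x *\<^sub>R h x) * (indicator {0..} x *\<^sub>R \<psi> (exp (- x)))) \<in> borel_measurable lborel"
      unfolding set_borel_measurable_def by simp
    then show ?thesis unfolding set_borel_measurable_def
      by (rule measurable_cong[THEN iffD1, rotated]) (auto simp: indicator_def)
  qed
  have inte: "set_integrable lborel {0..} (\<lambda>x. h x * \<psi> (exp (- x)))"
    if c: "continuous_on {0..1} \<psi>" for \<psi> :: "real \<Rightarrow> real"
  proof -
    obtain B where B: "\<And>t. t \<in> {0..1} \<Longrightarrow> \<bar>\<psi> t\<bar> \<le> B"
      using compact_imp_bounded[OF compact_continuous_image[OF c compact_Icc]]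
      unfolding bounded_iff by (metis image_eqI real_norm_def)
    have "set_integrable lborel {0..} (\<lambda>x. B * h x)" using int by simp
    then show ?thesis
    proof (rule set_integrable_bound[OF _ meas[OF c]], intro AE_I2 impI)
      fix x :: real assume "x \<in> {0..}"
      then have "\<bar>\<psi> (exp (- x))\<bar> \<le> \<bar>B\<bar>" using B[of "exp (- x)"] by auto
      then show "norm (h x * \<psi> (exp (- x))) \<le> norm (B * h x)"
        by (simp add: abs_mult mult.commute[of "\<bar>B\<bar>"] mult_left_mono)
    qed
  qed
  show "set_integrable lborel {0..} (\<lambda>x. h x * \<phi> (exp (- x)))" by (rule inte[OF cont])
  let ?H = "LINT x:{0..}|lborel. \<bar>h x\<bar>"
  have H0: "?H \<ge> 0" unfolding set_lebesgue_integral_def by (intro integral_nonneg_AE) auto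
  have "\<bar>LINT x:{0..}|lborel. h x * \<phi> (exp (- x))\<bar> \<le> e * (?H + 1)" if "e > 0" for e
  proof -
    obtain g where g: "real_polynomial_function g" "\<And>t. t \<in> {0..1} \<Longrightarrow> \<bar>\<phi> t - g t\<bar> < e"
      using Stone_Weierstrass_real_polynomial_function[OF compact_Icc cont \<open>e > 0\<close>] by blast
    then obtain a n where gs: "g = (\<lambda>x. \<Sum>i\<le>n. a i * x ^ i)"
      unfolding real_polynomial_function_iff_sum by blast
    have contg: "continuous_on {0..1} g" unfolding gs by (intro continuous_intros)
    have "(LINT x:{0..}|lborel. h x * g (exp (- x)))
        = (LINT x:{0..}|lborel. (\<Sum>i\<le>n. a i * (h x * exp (- x) ^ i)))"
      unfolding gs by (simp add: sum_distrib_left mult_ac)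
    also have "\<dots> = (\<Sum>i\<le>n. LINT x:{0..}|lborel. a i * (h x * exp (- x) ^ i))"
      unfolding set_lebesgue_integral_def scaleR_sum_right
      using inte[of "\<lambda>t. t ^ _"]
      by (intro Bochner_Integration.integral_sum) (auto simp: set_integrable_def continuous_intros mult.left_commute)
    also have "\<dots> = 0" by (simp add: mom)
    finally have g0: "(LINT x:{0..}|lborel. h x * g (exp (- x))) = 0" .
    have d: "continuous_on {0..1} (\<lambda>t. \<phi> t - g t)" by (intro continuous_intros cont contg)
    have "(LINT x:{0..}|lborel. h x * \<phi> (exp (- x)))
        = (LINT x:{0..}|lborel. h x * \<phi> (exp (- x))) - (LINT x:{0..}|lborel. h x * g (exp (- x)))"
      by (simp add: g0)
    also have "\<dots> = (LINT x:{0..}|lborel. h x * (\<phi> (exp (- x)) - g (exp (- x))))"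
      by (subst set_integral_diff(2)[symmetric]) (auto intro!: inte cont contg simp: algebra_simps)
    also have "\<bar>\<dots>\<bar> \<le> (LINT x:{0..}|lborel. \<bar>h x * (\<phi> (exp (- x)) - g (exp (- x)))\<bar>)"
      using set_integral_norm_bound[OF inte[OF d]] by simp
    also have "\<dots> \<le> (LINT x:{0..}|lborel. e * \<bar>h x\<bar>)"
    proof (rule set_integral_mono)
      show "set_integrable lborel {0..} (\<lambda>x. \<bar>h x * (\<phi> (exp (- x)) - g (exp (- x)))\<bar>)"
        using inte[OF d] by (rule set_integrable_abs)
      show "set_integrable lborel {0..} (\<lambda>x. e * \<bar>h x\<bar>)" using int by (simp add: set_integrable_abs)
      fix x :: real assume "x \<in> {0..}"
      then have "\<bar>\<phi> (exp (- x)) - g (exp (- x))\<bar> \<le> e" using g(2)[of "exp (- x)"] by auto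
      then show "\<bar>h x * (\<phi> (exp (- x)) - g (exp (- x)))\<bar> \<le> e * \<bar>h x\<bar>"
        by (simp add: abs_mult mult.commute[of e] mult_left_mono)
    qed
    also have "\<dots> = e * ?H" by simp
    also have "\<dots> \<le> e * (?H + 1)" using \<open>e > 0\<close> by simp
    finally show ?thesis .
  qed
  note * = this
  show "(LINT x:{0..}|lborel. h x * \<phi> (exp (- x))) = 0" (is "?I = 0")
  proof (rule ccontr)
    assume "?I \<noteq> 0"
    \<comment> \<open>\<open>k\<close> is positive even if \<open>h\<close> vanishes almost
      everywhere. Approximation error \<open>\<bar>?I\<bar> / (2 * k)\<close> then bounds
      \<open>\<bar>?I\<bar>\<close> by half of itself.\<close>
    define k where "k = ?H + 1"
    have k: "k > 0" using H0 by (simp add: k_def)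
    then have "\<bar>?I\<bar> \<le> \<bar>?I\<bar> / (2 * k) * k"
      unfolding k_def using \<open>?I \<noteq> 0\<close> by (intro *) simp
    also have "\<dots> = \<bar>?I\<bar> / 2" using k by simp
    finally show False using \<open>?I \<noteq> 0\<close> by simp
  qed
qed

text \<open>If \<open>f\<close> were positive at \<open>x0\<close>, a tent function in the variable
  \<open>exp (- x)\<close>, supported where \<open>f\<close> is positive, would give a nonnegative
  integrand with integral zero that is positive on an interval.\<close>

lemma laplace_eq_0_imp_not_pos:
  fixes f :: "real \<Rightarrow> real"
  assumes cont: "continuous_on {0..} f"
    and int: "\<And>\<beta>. \<beta> > B \<Longrightarrow> set_integrable lborel {0..} (\<lambda>x. exp (- \<beta> * x) * f x)"
    and zero: "\<And>\<beta>. \<beta> > B \<Longrightarrow> (LINT x:{0..}|lborel. exp (- \<beta> * x) * f x) = 0"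
    and "x0 \<ge> 0"
  shows "\<not> f x0 > 0"
proof
  assume pos: "f x0 > 0"
  \<comment> \<open>The weight \<open>B + 1\<close> makes \<open>h\<close> integrable. A further
    factor \<open>exp (- x) ^ n\<close> raises the exponent to \<open>B + 1 + n\<close>, still
    beyond \<open>B\<close>, so every moment is a vanishing Laplace integral.\<close>
  define h where "h x = exp (- (B + 1) * x) * f x" for x
  have inth: "set_integrable lborel {0..} h" unfolding h_def by (rule int) simp
  have mom: "(LINT x:{0..}|lborel. h x * exp (- x) ^ n) = 0" for n
  proof -
    have "h x * exp (- x) ^ n = exp (- (B + 1 + real n) * x) * f x" for x
      unfolding h_def by (simp add: exp_of_nat_mult[symmetric] mult_exp_exp algebra_simps)
    then show ?thesis using zero[of "B + 1 + real n"] by simp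
  qed
  obtain d where d: "d > 0" "\<And>x. x \<ge> 0 \<Longrightarrow> \<bar>x - x0\<bar> < d \<Longrightarrow> f x > 0"
  proof -
    obtain d where "d > 0" "\<forall>x\<in>{0..}. dist x x0 < d \<longrightarrow> dist (f x) (f x0) < f x0"
      using cont pos \<open>x0 \<ge> 0\<close> unfolding continuous_on_iff by (metis atLeast_iff)
    then show ?thesis by (intro that[of d]) (auto simp: dist_real_def abs_if split: if_splits)
  qed
  \<comment> \<open>Continuity of \<open>ln\<close> confines the support of the tent to the
    neighbourhood of \<open>x0\<close> where \<open>f\<close> is positive; the radius
    \<open>d'\<close> below serves the opposite direction and yields a whole interval on which the
    tent is positive.\<close>
  obtain r where r: "r > 0" "\<And>x. \<bar>exp (- x) - exp (- x0)\<bar> < r \<Longrightarrow> \<bar>x - x0\<bar> < d"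
  proof -
    have "isCont ln (exp (- x0))" by (simp add: isCont_ln)
    then obtain r where "r > 0" "\<forall>t. dist t (exp (- x0)) < r \<longrightarrow> dist (ln t) (ln (exp (- x0))) < d"
      using \<open>d > 0\<close> unfolding continuous_at_eps_delta dist_real_def by blast
    then show ?thesis by (intro that[of r]) (fastforce simp: dist_real_def)+
  qed
  obtain d' where d': "d' > 0" "\<And>x. \<bar>x - x0\<bar> < d' \<Longrightarrow> \<bar>exp (- x) - exp (- x0)\<bar> < r"
  proof -
    have "isCont (\<lambda>x. exp (- x)) x0" by (intro continuous_intros)
    then show ?thesis using that \<open>r > 0\<close> unfolding continuous_at_eps_delta dist_real_def by blast
  qed
  define \<phi> where "\<phi> t = max 0 (r - \<bar>t - exp (- x0)\<bar>)" for t
  have "continuous_on {0..1} \<phi>" unfolding \<phi>_def by (intro continuous_intros)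
  note I = exp_moments_eq_0_imp_integral_eq_0[OF inth mom this]
  have nonneg: "indicator {0..} x *\<^sub>R (h x * \<phi> (exp (- x))) \<ge> 0" for x
    using d(2)[of x] r(2)[of x] unfolding h_def \<phi>_def
    by (cases "x \<ge> 0 \<and> \<bar>exp (- x) - exp (- x0)\<bar> < r") (auto simp: indicator_def max_def)
  have "AE x in lborel. indicator {0..} x *\<^sub>R (h x * \<phi> (exp (- x))) = 0"
    using I nonneg unfolding set_integrable_def set_lebesgue_integral_def
    by (subst integral_nonneg_eq_0_iff_AE[symmetric]) auto
  \<comment> \<open>An interval to the right of \<open>x0\<close> stays inside the half-line even
    when \<open>x0 = 0\<close>.\<close>
  then have "AE x in lborel. x \<notin> {x0<..<x0 + d'}"
  proof eventually_elim
    case (elim x)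
    have "h x * \<phi> (exp (- x)) > 0" if "x \<in> {x0<..<x0 + d'}"
      using that d(2)[of x] r(2)[of x] d'(2)[of x] \<open>x0 \<ge> 0\<close> unfolding h_def \<phi>_def
      by (auto intro!: mult_pos_pos)
    with elim \<open>x0 \<ge> 0\<close> show ?case by (auto simp: indicator_def split: if_splits)
  qed
  then have "emeasure lborel {x0<..<x0 + d'} = 0"
    by (subst (asm) AE_iff_measurable[where N = "{x0<..<x0 + d'}"]) auto
  with \<open>d' > 0\<close> show False by simp
qed

text \<open>The previous lemma excludes both f - g > 0 and g - f > 0. Agreement beyond some
  \<open>B\<close> suffices, so transforms known on different half-lines can be compared beyond the
  larger of the two bounds.\<close>

theorem laplace_unique:
  fixes f g :: "real \<Rightarrow> real"
  assumes cont: "continuous_on {0..} f" "continuous_on {0..} g"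
    and int: "\<And>\<beta>. \<beta> > B \<Longrightarrow> set_integrable lborel {0..} (\<lambda>x. exp (- \<beta> * x) * f x)"
      "\<And>\<beta>. \<beta> > B \<Longrightarrow> set_integrable lborel {0..} (\<lambda>x. exp (- \<beta> * x) * g x)"
    and eq: "\<And>\<beta>. \<beta> > B \<Longrightarrow> (LINT x:{0..}|lborel. exp (- \<beta> * x) * f x)
                             = (LINT x:{0..}|lborel. exp (- \<beta> * x) * g x)"
    and "x \<ge> 0"
  shows "f x = g x"
proof -
  have "\<not> u x - v x > 0"
    if "continuous_on {0..} u" "continuous_on {0..} v"
      "\<And>\<beta>. \<beta> > B \<Longrightarrow> set_integrable lborel {0..} (\<lambda>x. exp (- \<beta> * x) * u x)"
      "\<And>\<beta>. \<beta> > B \<Longrightarrow> set_integrable lborel {0..} (\<lambda>x. exp (- \<beta> * x) * v x)"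
      "\<And>\<beta>. \<beta> > B \<Longrightarrow> (LINT x:{0..}|lborel. exp (- \<beta> * x) * u x)
                     = (LINT x:{0..}|lborel. exp (- \<beta> * x) * v x)" for u v :: "real \<Rightarrow> real"
  proof (rule laplace_eq_0_imp_not_pos[of "\<lambda>x. u x - v x" B])
    show "continuous_on {0..} (\<lambda>x. u x - v x)" using that by (intro continuous_intros)
    fix \<beta> assume "\<beta> > B"
    note i = that(3,4)[OF this]
    show "set_integrable lborel {0..} (\<lambda>x. exp (- \<beta> * x) * (u x - v x))"
      using set_integral_diff(1)[OF i] by (simp add: right_diff_distrib)
    show "(LINT x:{0..}|lborel. exp (- \<beta> * x) * (u x - v x)) = 0"
      using set_integral_diff(2)[OF i] that(5)[OF \<open>\<beta> > B\<close>] by (simp add: right_diff_distrib)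
  qed fact
  from this[of f g] this[of g f] show ?thesis using assms by fastforce
qed

section \<open>One-sided differentiation under the integral sign\<close>

text \<open>Dominated convergence for the difference quotients \<open>Q\<close>, which the Lipschitz
  constant \<open>B\<close> dominates, along arbitrary sequences in S - {x}. Working within a set
  \<open>S\<close> covers both one-sided derivatives.\<close>

lemma has_real_derivative_integral:
  fixes f :: "real \<Rightarrow> 'a \<Rightarrow> real"
  assumes f: "\<And>y. y \<in> S \<Longrightarrow> integrable M (f y)"
    and der: "AE \<omega> in M. ((\<lambda>y. f y \<omega>) has_real_derivative f' \<omega>) (at x within S)"
    and lip: "AE \<omega> in M. \<forall>y\<in>S. \<bar>f y \<omega> - f x \<omega>\<bar> \<le> B \<omega> * \<bar>y - x\<bar>"
    and B: "integrable M B" and f'[measurable]: "f' \<in> borel_measurable M" and "x \<in> S"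
    and nt: "at x within S \<noteq> bot"
  shows "integrable M f'"
    and "((\<lambda>y. \<integral>\<omega>. f y \<omega> \<partial>M) has_real_derivative (\<integral>\<omega>. f' \<omega> \<partial>M)) (at x within S)"
proof -
  define Q where "Q y \<omega> = (f y \<omega> - f x \<omega>) / (y - x)" for y \<omega>
  have Qint: "integrable M (Q y)" if "y \<in> S" for y
    unfolding Q_def using f[OF that] f[OF \<open>x \<in> S\<close>] by simp
  have lim: "AE \<omega> in M. (\<lambda>i. Q (X i) \<omega>) \<longlonglongrightarrow> f' \<omega>" if X: "\<forall>i. X i \<in> S - {x}" "X \<longlonglongrightarrow> x" for X :: "nat \<Rightarrow> real"
    using der
  proof eventually_elim
    case (elim \<omega>)
    then have "((\<lambda>y. Q y \<omega>) \<longlongrightarrow> f' \<omega>) (at x within S)"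
      unfolding Q_def has_field_derivative_iff .
    then show ?case using X unfolding tendsto_at_iff_sequentially comp_def by blast
  qed
  have bnd: "AE \<omega> in M. norm (Q y \<omega>) \<le> B \<omega>" if "y \<in> S - {x}" for y
    using lip by eventually_elim (use that in \<open>auto simp: Q_def abs_mult field_simps\<close>)
  have dom: "integrable M f'" "(\<lambda>i. \<integral>\<omega>. Q (X i) \<omega> \<partial>M) \<longlonglongrightarrow> (\<integral>\<omega>. f' \<omega> \<partial>M)"
    if X: "\<forall>i. X i \<in> S - {x}" "X \<longlonglongrightarrow> x" for X :: "nat \<Rightarrow> real"
    using X bnd Qint lim[OF X]
    by (intro integrable_dominated_convergence[of f' M "\<lambda>i. Q (X i)" B]
        integral_dominated_convergence[of f' M "\<lambda>i. Q (X i)" B] B f' borel_measurable_integrable; force)+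
  \<comment> \<open>Nontriviality of the filter provides one such sequence, and integrability of the
    limit \<open>f'\<close> comes from dominated convergence along it.\<close>
  obtain X where "\<forall>i::nat. X i \<in> S - {x}" "X \<longlonglongrightarrow> x"
    using nt unfolding trivial_limit_within islimpt_sequential by metis
  then show "integrable M f'" by (rule dom)
  have "((\<lambda>y. \<integral>\<omega>. Q y \<omega> \<partial>M) \<longlongrightarrow> (\<integral>\<omega>. f' \<omega> \<partial>M)) (at x within S)"
    unfolding tendsto_at_iff_sequentially comp_def using dom(2) by blast
  moreover have "\<forall>\<^sub>F y in at x within S. (\<integral>\<omega>. Q y \<omega> \<partial>M) = ((\<integral>\<omega>. f y \<omega> \<partial>M) - (\<integral>\<omega>. f x \<omega> \<partial>M)) / (y - x)"
    unfolding eventually_at_filter Q_def using f \<open>x \<in> S\<close> by (auto intro!: always_eventually)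
  ultimately show "((\<lambda>y. \<integral>\<omega>. f y \<omega> \<partial>M) has_real_derivative (\<integral>\<omega>. f' \<omega> \<partial>M)) (at x within S)"
    unfolding has_field_derivative_iff by (rule Lim_transform_eventually)
qed

section \<open>The kernel of the scale function\<close>

text \<open>For \<open>n = 0\<close> the convention \<open>0 ^ 0 = 1\<close> makes the kernel smooth on the whole line, so that no
  jump at the origin has to be treated; it is only ever evaluated at nonnegative arguments then.\<close>

definition kern :: "real \<Rightarrow> real \<Rightarrow> nat \<Rightarrow> real \<Rightarrow> real" where
  "kern c a n u = (- max u 0 / c) ^ n * exp (a / c * u)"

lemma kern_measurable[measurable]: "kern c a n \<in> borel_measurable borel"
  unfolding kern_def by measurable

lemma kern_bound:
  assumes "c > 0" "a \<ge> 0" "u \<le> b" "b \<ge> 0"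
  shows "\<bar>kern c a n u\<bar> \<le> (b / c) ^ n * exp (a / c * b)"
  unfolding kern_def abs_mult power_abs using assms
  by (intro mult_mono power_mono) (auto simp: divide_right_mono mult_left_mono divide_nonneg_pos)

text \<open>The difference factors as x - y times a sum of \<open>n\<close> products of degree n -
  1, each at most \<open>r ^ (n - 1)\<close>.\<close>

lemma abs_power_diff_le:
  fixes x y r :: real
  assumes "\<bar>x\<bar> \<le> r" "\<bar>y\<bar> \<le> r"
  shows "\<bar>x ^ n - y ^ n\<bar> \<le> real n * r ^ (n - 1) * \<bar>x - y\<bar>"
proof -
  have r: "r \<ge> 0" using assms by linarith
  show ?thesis
  proof (cases n)
    case (Suc m)
    have "\<bar>\<Sum>p<Suc m. x ^ p * y ^ (m - p)\<bar> \<le> (\<Sum>p<Suc m. \<bar>x ^ p * y ^ (m - p)\<bar>)" by (rule sum_abs)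
    also have "\<dots> \<le> (\<Sum>p<Suc m. r ^ p * r ^ (m - p))"
      unfolding abs_mult power_abs using assms r by (intro sum_mono mult_mono power_mono) auto
    also have "\<dots> = (\<Sum>p<Suc m. r ^ m)"
      by (intro sum.cong refl) (auto simp: power_add[symmetric])
    finally have "\<bar>\<Sum>p<Suc m. x ^ p * y ^ (m - p)\<bar> \<le> real n * r ^ (n - 1)" by (simp add: Suc)
    then show ?thesis unfolding Suc diff_power_eq_sum abs_mult
      by (metis Suc abs_ge_zero mult.commute mult_right_mono)
  qed simp
qed

text \<open>The bound mirrors the product rule. Its dependence on \<open>n\<close> is explicit
  because \<open>n\<close> will be the Poisson number of jumps and the constant must then have
  finite expectation.\<close>

lemma kern_lipschitz:
  assumes "c > 0" "a \<ge> 0" "u \<le> b" "v \<le> b" "b \<ge> 0"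
  shows "\<bar>kern c a n u - kern c a n v\<bar>
           \<le> (real n * (b / c) ^ (n - 1) / c + (b / c) ^ n * (a / c)) * exp (a / c * b) * \<bar>u - v\<bar>"
proof -
  let ?m = "\<lambda>u. - max u 0 / c" let ?e = "\<lambda>u. exp (a / c * u)"
  have m: "\<bar>?m u\<bar> \<le> b / c" "\<bar>?m v\<bar> \<le> b / c" using assms by (auto simp: divide_right_mono)
  have "\<bar>?m u - ?m v\<bar> = \<bar>max u 0 - max v 0\<bar> / c"
    using \<open>c > 0\<close> by (simp add: diff_divide_distrib[symmetric] abs_minus_commute)
  also have "\<dots> \<le> \<bar>u - v\<bar> / c" using \<open>c > 0\<close> by (intro divide_right_mono) auto
  finally have md: "\<bar>?m u - ?m v\<bar> \<le> \<bar>u - v\<bar> / c" .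
  have "\<bar>?m u ^ n - ?m v ^ n\<bar> \<le> real n * (b / c) ^ (n - 1) * \<bar>?m u - ?m v\<bar>"
    by (rule abs_power_diff_le[OF m])
  also have "\<dots> \<le> real n * (b / c) ^ (n - 1) * (\<bar>u - v\<bar> / c)"
    using md assms by (intro mult_left_mono) auto
  finally have pd: "\<bar>?m u ^ n - ?m v ^ n\<bar> \<le> real n * (b / c) ^ (n - 1) / c * \<bar>u - v\<bar>" by simp
  \<comment> \<open>Mean value estimate on the half-line below \<open>b\<close>: since
    \<open>a / c\<close> is nonnegative, the derivative of the exponential is largest at
    \<open>b\<close>.\<close>
  have "norm (?e u - ?e v) \<le> (a / c * exp (a / c * b)) * norm (u - v)"
  proof (rule field_differentiable_bound[of "{..b}" ?e "\<lambda>u. exp (a / c * u) * (a / c)"])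
    fix z assume "z \<in> {..b}"
    then have "exp (a / c * z) \<le> exp (a / c * b)" using assms by (simp add: mult_left_mono divide_right_mono)
    then show "norm (exp (a / c * z) * (a / c)) \<le> a / c * exp (a / c * b)"
      using assms by (simp add: abs_mult mult.commute mult_left_mono divide_right_mono)
  qed (use assms in \<open>auto intro!: derivative_eq_intros\<close>)
  then have ed: "\<bar>?e u - ?e v\<bar> \<le> a / c * exp (a / c * b) * \<bar>u - v\<bar>" by simp
  have "kern c a n u - kern c a n v = (?m u ^ n - ?m v ^ n) * ?e u + ?m v ^ n * (?e u - ?e v)"
    unfolding kern_def by (simp add: algebra_simps)
  also have "\<bar>\<dots>\<bar> \<le> \<bar>?m u ^ n - ?m v ^ n\<bar> * \<bar>?e u\<bar> + \<bar>?m v ^ n\<bar> * \<bar>?e u - ?e v\<bar>"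
    by (metis abs_mult abs_triangle_ineq)
  also have "\<dots> \<le> (real n * (b / c) ^ (n - 1) / c * \<bar>u - v\<bar>) * exp (a / c * b)
      + (b / c) ^ n * (a / c * exp (a / c * b) * \<bar>u - v\<bar>)"
  proof (rule add_mono)
    have "\<bar>?e u\<bar> \<le> exp (a / c * b)" using assms by (simp add: mult_left_mono divide_right_mono)
    then show "\<bar>?m u ^ n - ?m v ^ n\<bar> * \<bar>?e u\<bar>
        \<le> (real n * (b / c) ^ (n - 1) / c * \<bar>u - v\<bar>) * exp (a / c * b)"
      using pd by (intro mult_mono) auto
    have "\<bar>?m v ^ n\<bar> \<le> (b / c) ^ n" unfolding power_abs using m by (intro power_mono) auto
    then show "\<bar>?m v ^ n\<bar> * \<bar>?e u - ?e v\<bar> \<le> (b / c) ^ n * (a / c * exp (a / c * b) * \<bar>u - v\<bar>)"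
      using ed assms by (intro mult_mono) auto
  qed
  finally show ?thesis by (simp add: algebra_simps)
qed

text \<open>\<open>d\<close> stands for the derivative of the positive part, so one formula serves
  both sides of the kink. At \<open>n = 0\<close> the truncated exponent n - 1 is harmless, being
  multiplied by \<open>real n\<close>.\<close>

definition kern_deriv :: "real \<Rightarrow> real \<Rightarrow> nat \<Rightarrow> real \<Rightarrow> real \<Rightarrow> real" where
  "kern_deriv c a n d u =
     (real n * (- d / c * (- max u 0 / c) ^ (n - 1)) + (- max u 0 / c) ^ n * (a / c)) * exp (a / c * u)"

lemma kern_has_derivative:
  assumes "((\<lambda>y. max (y - s) 0) has_real_derivative d) (at x within A)"
  shows "((\<lambda>y. kern c a n (y - s)) has_real_derivative kern_deriv c a n d (x - s)) (at x within A)"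
proof -
  have 1: "((\<lambda>y. - max (y - s) 0 / c) has_real_derivative - d / c) (at x within A)"
    using DERIV_cdivide[OF DERIV_minus[OF assms]] .
  show ?thesis unfolding kern_def kern_deriv_def
    by (rule derivative_eq_intros 1 refl)+ (simp add: algebra_simps)
qed

text \<open>At the kink \<open>s = x\<close> the right derivative of the positive part is 1 and the
  left one is 0. This is the source of the closed indicator in the right-hand formula and of the
  open one in the left-hand formula.\<close>

lemma max_has_right_derivative:
  assumes "x \<le> b"
  shows "((\<lambda>y. max (y - s) 0) has_real_derivative (if s \<le> x then 1 else 0)) (at x within {x..b::real})"
proof (cases "s \<le> x")
  case True
  have "((\<lambda>y. y - s) has_real_derivative 1) (at x within {x..b})" by (auto intro!: derivative_eq_intros)
  then have "((\<lambda>y. max (y - s) 0) has_real_derivative 1) (at x within {x..b})"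
    by (rule has_field_derivative_transform_within[where d = 1]) (use True assms in auto)
  then show ?thesis using True by simp
next
  case False
  have "((\<lambda>y. max (y - s) 0) has_real_derivative 0) (at x within {x..b})"
    by (rule has_field_derivative_transform_within[where d = "s - x" and f = "\<lambda>y. 0"])
      (use False assms in \<open>auto simp: dist_real_def\<close>)
  then show ?thesis using False by simp
qed

lemma max_has_left_derivative:
  assumes "b \<le> x"
  shows "((\<lambda>y. max (y - s) 0) has_real_derivative (if s < x then 1 else 0)) (at x within {b..x::real})"
proof (cases "s < x")
  case True
  have "((\<lambda>y. y - s) has_real_derivative 1) (at x within {b..x})" by (auto intro!: derivative_eq_intros)
  then have "((\<lambda>y. max (y - s) 0) has_real_derivative 1) (at x within {b..x})"
    by (rule has_field_derivative_transform_within[where d = "x - s"])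
      (use True assms in \<open>auto simp: dist_real_def\<close>)
  then show ?thesis using True by simp
next
  case False
  have "((\<lambda>y. max (y - s) 0) has_real_derivative 0) (at x within {b..x})"
    by (rule has_field_derivative_transform_within[where d = 1 and f = "\<lambda>y. 0"])
      (use False assms in \<open>auto simp: dist_real_def\<close>)
  then show ?thesis using False by simp
qed

text \<open>With l = u + c one has 1 - l/c = -u/c, and the constant \<open>exp (- (q + lam))\<close>
  undoes the shift by \<open>c\<close> in the exponential. \<open>P\<close> says that the path
  counts. If it fails then n > 0 and the positive part of \<open>u\<close> is 0, so both sides
  vanish.\<close>

lemma kern_deriv_eq_deriv_integrand:
  assumes "c > 0" "n = 0 \<Longrightarrow> P" "P \<Longrightarrow> u \<ge> 0" "\<not> P \<Longrightarrow> u \<le> 0"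
  shows "kern_deriv c (q + lam) n (if P then 1 else 0) u
           = exp (- (q + lam)) / c * (deriv_integrand c lam q (u + c) n * (if P then 1 else 0))"
proof -
  have e: "exp ((q + lam) / c * (u + c)) = exp ((q + lam) / c * u) * exp (q + lam)"
    using \<open>c > 0\<close> by (simp add: exp_add[symmetric] field_simps)
  have l: "1 - (u + c) / c = - u / c" using \<open>c > 0\<close> by (simp add: field_simps)
  define E where "E = exp (q + lam)"
  define F where "F = exp ((q + lam) / c * u)"
  have "E \<noteq> 0" by (simp add: E_def)
  then show ?thesis
    unfolding kern_deriv_def deriv_integrand_def e l exp_minus E_def[symmetric] F_def[symmetric]
    using assms by (cases n) (auto simp: field_simps)
qed

section \<open>Laplace transform and primitive of the kernel\<close>

lemma has_bochner_integral_power_exp: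
  fixes b :: real assumes "b > 0"
  shows "has_bochner_integral lborel (\<lambda>t. indicator {0..} t * (t ^ n * exp (- b * t))) (fact n / b ^ (n + 1))"
proof -
  \<comment> \<open>Up to the factor \<open>fact n / b ^ (n + 1)\<close> the integrand is the Erlang
    density, whose zeroth moment is 1.\<close>
  have "has_bochner_integral lborel (erlang_density n b) 1"
    using nn_integral_erlang_ith_moment[OF assms, of n 0] assms
    by (intro has_bochner_integral_nn_integral) auto
  then have "has_bochner_integral lborel (\<lambda>t. fact n / b ^ (n + 1) * erlang_density n b t) (fact n / b ^ (n + 1) * 1)"
    by (intro has_bochner_integral_mult_right)
  moreover have "fact n / b ^ (n + 1) * erlang_density n b t = indicator {0..} t * (t ^ n * exp (- b * t))" for t
    using assms by (auto simp: erlang_density_def indicator_def)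
  ultimately show ?thesis by simp
qed

text \<open>The shift x = s + t turns both integrals into gamma integrals; the one with absolute
  values will justify Fubini. For n > 0 the kernel vanishes at negative arguments, while for
  \<open>n = 0\<close> it does not, and \<open>s = 0\<close> takes over.\<close>

lemma has_bochner_integral_kern_laplace:
  assumes "c > 0" "b > a / c" "s \<ge> 0" "n = 0 \<Longrightarrow> s = 0"
  shows "has_bochner_integral lborel (\<lambda>x. indicator {0..} x * (exp (- b * x) * kern c a n (x - s)))
           (exp (- b * s) * (- 1 / c) ^ n * fact n / (b - a / c) ^ (n + 1))"
    and "has_bochner_integral lborel (\<lambda>x. \<bar>indicator {0..} x * (exp (- b * x) * kern c a n (x - s))\<bar>)
           (exp (- b * s) * (1 / c) ^ n * fact n / (b - a / c) ^ (n + 1))"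
proof -
  have *: "indicator {0..} (s + 1 * t) * (exp (- b * (s + 1 * t)) * kern c a n (s + 1 * t - s))
     = exp (- b * s) * (- 1 / c) ^ n * (indicator {0..} t * (t ^ n * exp (- (b - a / c) * t)))" for t
  proof (cases "t \<ge> 0")
    case True
    have "exp (- b * (s + t)) * exp (a / c * t) = exp (- b * s) * exp (- (b - a / c) * t)"
      by (simp add: exp_add[symmetric] algebra_simps)
    moreover have "(- t / c) ^ n = (- 1 / c) ^ n * t ^ n" by (simp add: power_mult_distrib[symmetric])
    ultimately show ?thesis using True \<open>s \<ge> 0\<close> unfolding kern_def by (simp add: mult_ac)
  next
    case False
    then show ?thesis using assms(4) by (cases n) (auto simp: kern_def indicator_def)
  qed
  have b: "b - a / c > 0" using assms by simp
  show "has_bochner_integral lborel (\<lambda>x. indicator {0..} x * (exp (- b * x) * kern c a n (x - s)))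
           (exp (- b * s) * (- 1 / c) ^ n * fact n / (b - a / c) ^ (n + 1))"
    by (subst lborel_has_bochner_integral_real_affine_iff[where c = 1 and t = s], simp)
      (use has_bochner_integral_mult_right[OF has_bochner_integral_power_exp[OF b], of "exp (- b * s) * (- 1 / c) ^ n"]
        in \<open>simp only: * , simp\<close>)
  show "has_bochner_integral lborel (\<lambda>x. \<bar>indicator {0..} x * (exp (- b * x) * kern c a n (x - s))\<bar>)
           (exp (- b * s) * (1 / c) ^ n * fact n / (b - a / c) ^ (n + 1))"
  proof (subst lborel_has_bochner_integral_real_affine_iff[where c = 1 and t = s], simp, unfold *)
    have "\<bar>exp (- b * s) * (- 1 / c) ^ n * (indicator {0..} t * (t ^ n * exp (- (b - a / c) * t)))\<bar>
       = exp (- b * s) * (1 / c) ^ n * (indicator {0..} t * (t ^ n * exp (- (b - a / c) * t)))" for t :: real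
      using \<open>c > 0\<close> by (auto simp: abs_mult power_abs indicator_def)
    then show "has_bochner_integral lborel
      (\<lambda>t. \<bar>exp (- b * s) * (- 1 / c) ^ n * (indicator {0..} t * (t ^ n * exp (- (b - a / c) * t)))\<bar>)
      (exp (- b * s) * (1 / c) ^ n * fact n / (b - a / c) ^ (n + 1) /\<^sub>R \<bar>1\<bar>)"
      using has_bochner_integral_mult_right[OF has_bochner_integral_power_exp[OF b], of "exp (- b * s) * (1 / c) ^ n"]
      by simp
  qed
qed

text \<open>Substitute y = s + c t; the kernel becomes \<open>exp (a * t) * (- t) ^ n\<close>. The
  indicator costs nothing: for x at most \<open>s\<close> the new interval is empty or the null set
  {0}.\<close>

lemma integral_kern:
  assumes "c > 0" "s \<ge> 0" "n = 0 \<Longrightarrow> s = 0"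
  shows "(LINT y:{0..x}|lborel. kern c a n (y - s))
       = c * ((LINT y:{0..(x - s) / c}|lborel. exp (a * y) * (- y) ^ n) * indicator {0<..} (x - s))"
proof -
  have *: "indicator {0..x} (s + c * t) *\<^sub>R kern c a n (s + c * t - s)
      = indicator {0..(x - s) / c} t *\<^sub>R (exp (a * t) * (- t) ^ n)" for t
  proof (cases "t \<ge> 0")
    case True
    have "(s + c * t \<le> x) = (t \<le> (x - s) / c)" using \<open>c > 0\<close> by (simp add: field_simps)
    then show ?thesis using True assms by (auto simp: kern_def indicator_def)
  next
    case False
    then have "c * t < 0" using \<open>c > 0\<close> by (simp add: mult_pos_neg)
    then show ?thesis using False assms by (cases n) (auto simp: kern_def indicator_def)
  qed
  have "(LINT y:{0..x}|lborel. kern c a n (y - s))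
      = c * (LINT y:{0..(x - s) / c}|lborel. exp (a * y) * (- y) ^ n)" (is "_ = c * ?J")
    unfolding set_lebesgue_integral_def
    by (subst lborel_integral_real_affine[where c = c and t = s]) (use \<open>c > 0\<close> in \<open>simp_all only: * , simp_all\<close>)
  moreover have "?J = 0" if "x - s \<le> 0"
  proof -
    have "(x - s) / c \<le> 0" using that \<open>c > 0\<close> by (simp add: divide_nonpos_pos)
    then have sub: "{0..(x - s) / c} \<subseteq> {0}" by auto
    have "AE y in lborel. indicator {0..(x - s) / c} y *\<^sub>R (exp (a * y) * (- y) ^ n) = 0"
      using AE_lborel_singleton[of 0] by eventually_elim (use sub in \<open>auto simp: indicator_def\<close>)
    then show ?thesis unfolding set_lebesgue_integral_def by (rule integral_eq_zero_AE)
  qed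
  ultimately show ?thesis by (auto simp: indicator_def)
qed

section \<open>The scale function as an expectation\<close>

text \<open>The process at time one: \<open>K\<close> counts the jumps, \<open>S\<close> is their
  sum and \<open>p\<close> the Laplace transform of a single jump. \<open>S_laplace\<close> reads
  E[exp(-b S); K = n] = P(K = n) p(b)^n, and in it lies all the independence that the analysis
  uses.\<close>

locale poisson_sum = prob_space M for M :: "'a measure" +
  fixes K :: "'a \<Rightarrow> nat" and S :: "'a \<Rightarrow> real" and lam :: real and p :: "real \<Rightarrow> real"
  assumes lam_pos: "lam > 0"
    and K_measurable[measurable]: "K \<in> measurable M (count_space UNIV)"
    and S_measurable[measurable]: "S \<in> borel_measurable M"
    and K_distr: "distr M (count_space UNIV) K = measure_pmf (poisson_pmf lam)"
    and S_nonneg: "AE \<omega> in M. S \<omega> \<ge> 0"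
    and S_zero: "K \<omega> = 0 \<Longrightarrow> S \<omega> = 0"
    and S_laplace: "b \<ge> 0 \<Longrightarrow> (\<integral>\<omega>. indicator {n} (K \<omega>) * exp (- b * S \<omega>) \<partial>M) = lam ^ n / fact n * exp (- lam) * p b ^ n"
    and p_bounds: "b \<ge> 0 \<Longrightarrow> 0 \<le> p b" "b \<ge> 0 \<Longrightarrow> p b \<le> 1"
begin

section \<open>Expectations of functions of the number of jumps\<close>

lemma measurable_K_family:
  assumes "\<And>n. f n \<in> borel_measurable M"
  shows "(\<lambda>\<omega>. f (K \<omega>) \<omega>) \<in> borel_measurable M"
  using assms by (rule measurable_compose_countable) simp

lemma integrable_function_K:
  fixes h :: "nat \<Rightarrow> real"
  assumes "summable (\<lambda>n. \<bar>h n\<bar> * lam ^ n / fact n)"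
  shows "integrable M (\<lambda>\<omega>. h (K \<omega>))"
proof -
  have "summable (\<lambda>n. \<bar>h n\<bar> * lam ^ n / fact n * exp (- lam))" using assms by (rule summable_mult2)
  then have "integrable (measure_pmf (poisson_pmf lam)) h"
    unfolding measure_pmf_eq_density using lam_pos
    by (subst integrable_density) (auto simp: integrable_count_space_nat_iff abs_mult mult_ac)
  then show ?thesis
    unfolding K_distr[symmetric] by (subst (asm) integrable_distr_eq) auto
qed

text \<open>The exponential is almost surely at most 1, so \<open>h (K \<omega>)\<close> dominates.
  Splitting the space by the value of \<open>K\<close> and using countable additivity reduces the
  expectation to \<open>S_laplace\<close>.\<close>

lemma expectation_laplace_K:
  fixes h :: "nat \<Rightarrow> real"
  assumes b: "b \<ge> 0" and h: "summable (\<lambda>n. \<bar>h n\<bar> * lam ^ n / fact n)"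
  shows "integrable M (\<lambda>\<omega>. exp (- b * S \<omega>) * h (K \<omega>))"
    and "(\<integral>\<omega>. exp (- b * S \<omega>) * h (K \<omega>) \<partial>M) = (\<Sum>n. h n * (lam ^ n / fact n * exp (- lam) * p b ^ n))"
proof -
  have [measurable]: "(\<lambda>\<omega>. h (K \<omega>)) \<in> borel_measurable M" by (rule measurable_compose[OF K_measurable]) simp
  show int: "integrable M (\<lambda>\<omega>. exp (- b * S \<omega>) * h (K \<omega>))"
  proof (rule Bochner_Integration.integrable_bound[OF integrable_function_K[OF h]])
    show "AE \<omega> in M. norm (exp (- b * S \<omega>) * h (K \<omega>)) \<le> norm (h (K \<omega>))"
      using S_nonneg
    proof eventually_elim
      case (elim \<omega>)
      have "exp (- b * S \<omega>) \<le> 1" using elim b by simp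
      then show ?case by (simp add: abs_mult mult_left_le_one_le)
    qed
  qed measurable
  define A where "A n = K -` {n} \<inter> space M" for n
  have U: "(\<Union>n. A n) = space M" by (auto simp: A_def)
  have "(\<integral>\<omega>. exp (- b * S \<omega>) * h (K \<omega>) \<partial>M) = (LINT \<omega>:(\<Union>n. A n)|M. exp (- b * S \<omega>) * h (K \<omega>))"
    unfolding U by (rule set_integral_space[OF int, symmetric])
  also have "\<dots> = (\<Sum>n. LINT \<omega>:A n|M. exp (- b * S \<omega>) * h (K \<omega>))"
  proof (rule lebesgue_integral_countable_add)
    show "set_integrable M (\<Union>n. A n) (\<lambda>\<omega>. exp (- b * S \<omega>) * h (K \<omega>))"
      unfolding U set_integrable_def by (rule integrable_mult_indicator[OF sets.top int])
  qed (auto simp: A_def)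
  also have "\<dots> = (\<Sum>n. h n * (lam ^ n / fact n * exp (- lam) * p b ^ n))"
  proof (rule suminf_cong)
    fix n
    have "(LINT \<omega>:A n|M. exp (- b * S \<omega>) * h (K \<omega>)) = (\<integral>\<omega>. h n * (indicator {n} (K \<omega>) * exp (- b * S \<omega>)) \<partial>M)"
      unfolding set_lebesgue_integral_def A_def
      by (intro Bochner_Integration.integral_cong) (auto simp: indicator_def)
    then show "(LINT \<omega>:A n|M. exp (- b * S \<omega>) * h (K \<omega>)) = h n * (lam ^ n / fact n * exp (- lam) * p b ^ n)"
      by (simp only: integral_mult_right_zero S_laplace[OF b])
  qed
  finally show "(\<integral>\<omega>. exp (- b * S \<omega>) * h (K \<omega>) \<partial>M) = (\<Sum>n. h n * (lam ^ n / fact n * exp (- lam) * p b ^ n))" .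
qed

lemma integrable_power_K: "integrable M (\<lambda>\<omega>. r ^ K \<omega>)" for r :: real
proof (rule integrable_function_K)
  show "summable (\<lambda>n. \<bar>r ^ n\<bar> * lam ^ n / fact n)"
    using summable_exp[of "\<bar>r\<bar> * lam"] by (simp add: power_abs power_mult_distrib field_simps)
qed

lemma integrable_deriv_power_K: "integrable M (\<lambda>\<omega>. real (K \<omega>) * r ^ (K \<omega> - 1))" for r :: real
proof (rule integrable_function_K)
  \<comment> \<open>The term of index 0 vanishes, and after the shift to n + 1 the factor n + 1
    cancels against the factorial, leaving an exponential series.\<close>
  have "summable (\<lambda>n. lam * (inverse (fact n) * (\<bar>r\<bar> * lam) ^ n))"
    by (intro summable_mult summable_exp)
  also have "(\<lambda>n. lam * (inverse (fact n) * (\<bar>r\<bar> * lam) ^ n))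
      = (\<lambda>n. \<bar>real (Suc n) * r ^ (Suc n - 1)\<bar> * lam ^ Suc n / fact (Suc n))"
    by (auto simp: fun_eq_iff abs_mult power_abs power_mult_distrib field_simps simp del: of_nat_Suc)
  finally show "summable (\<lambda>n. \<bar>real n * r ^ (n - 1)\<bar> * lam ^ n / fact n)"
    by (subst (asm) summable_Suc_iff)
qed

lemma integrable_kern:
  assumes "c > 0" "a \<ge> 0"
  shows "integrable M (\<lambda>\<omega>. kern c a (K \<omega>) (x - S \<omega>))"
proof (rule Bochner_Integration.integrable_bound)
  show "integrable M (\<lambda>\<omega>. (\<bar>x\<bar> / c) ^ K \<omega> * exp (a / c * \<bar>x\<bar>))"
    by (intro integrable_mult_left integrable_power_K)
  show "(\<lambda>\<omega>. kern c a (K \<omega>) (x - S \<omega>)) \<in> borel_measurable M" by (rule measurable_K_family) simp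
  show "AE \<omega> in M. norm (kern c a (K \<omega>) (x - S \<omega>)) \<le> norm ((\<bar>x\<bar> / c) ^ K \<omega> * exp (a / c * \<bar>x\<bar>))"
    using S_nonneg
  proof eventually_elim
    case (elim \<omega>)
    then show ?case using kern_bound[of c a "x - S \<omega>" "\<bar>x\<bar>" "K \<omega>"] assms by (simp add: abs_mult)
  qed
qed

section \<open>The candidate for the scale function and its one-sided derivatives\<close>

definition scale_fun :: "real \<Rightarrow> real \<Rightarrow> real \<Rightarrow> real" where
  "scale_fun c a x = exp lam / c * (\<integral>\<omega>. kern c a (K \<omega>) (x - S \<omega>) \<partial>M)"

lemma scale_fun_has_derivative:
  assumes "c > 0" "a \<ge> 0" and A: "x \<in> A" "\<And>y. y \<in> A \<Longrightarrow> y \<le> b" "b \<ge> 0" "at x within A \<noteq> bot"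
    and d: "\<And>s. ((\<lambda>y. max (y - s) 0) has_real_derivative d s) (at x within A)"
    and [measurable]: "d \<in> borel_measurable borel"
  shows "integrable M (\<lambda>\<omega>. kern_deriv c a (K \<omega>) (d (S \<omega>)) (x - S \<omega>))"
    and "(scale_fun c a has_real_derivative exp lam / c * (\<integral>\<omega>. kern_deriv c a (K \<omega>) (d (S \<omega>)) (x - S \<omega>) \<partial>M)) (at x within A)"
proof -
  \<comment> \<open>Lipschitz constant of the kernel for arguments up to \<open>b\<close>. Since
    \<open>S\<close> is almost surely nonnegative, it applies to \<open>x - S \<omega>\<close> and
    \<open>y - S \<omega>\<close> alike; its expectation is finite because \<open>r ^ K\<close> and
    \<open>K * r ^ (K - 1)\<close> are integrable.\<close>
  define B where "B \<omega> = (real (K \<omega>) * (b / c) ^ (K \<omega> - 1) / c + (b / c) ^ K \<omega> * (a / c)) * exp (a / c * b)" for \<omega>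
  have B: "integrable M B" unfolding B_def
    by (intro integrable_mult_left Bochner_Integration.integrable_add integrable_divide
        integrable_deriv_power_K integrable_power_K)
  have der: "AE \<omega> in M. ((\<lambda>y. kern c a (K \<omega>) (y - S \<omega>)) has_real_derivative
      kern_deriv c a (K \<omega>) (d (S \<omega>)) (x - S \<omega>)) (at x within A)"
    by (intro AE_I2 kern_has_derivative d)
  have lip: "AE \<omega> in M. \<forall>y\<in>A. \<bar>kern c a (K \<omega>) (y - S \<omega>) - kern c a (K \<omega>) (x - S \<omega>)\<bar> \<le> B \<omega> * \<bar>y - x\<bar>"
    using S_nonneg
  proof eventually_elim
    case (elim \<omega>)
    show ?case
    proof
      fix y assume "y \<in> A"
      then have "y - S \<omega> \<le> b" "x - S \<omega> \<le> b" using A(2)[of y] A(2)[of x] A(1) elim by auto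
      from kern_lipschitz[OF assms(1,2) this \<open>b \<ge> 0\<close>, of "K \<omega>"]
      show "\<bar>kern c a (K \<omega>) (y - S \<omega>) - kern c a (K \<omega>) (x - S \<omega>)\<bar> \<le> B \<omega> * \<bar>y - x\<bar>"
        unfolding B_def by simp
    qed
  qed
  have meas: "(\<lambda>\<omega>. kern_deriv c a (K \<omega>) (d (S \<omega>)) (x - S \<omega>)) \<in> borel_measurable M"
    by (rule measurable_K_family) (unfold kern_deriv_def, measurable)
  note * = has_real_derivative_integral[OF integrable_kern[OF assms(1,2)] der lip B meas A(1,4)]
  show "integrable M (\<lambda>\<omega>. kern_deriv c a (K \<omega>) (d (S \<omega>)) (x - S \<omega>))" by (rule *)
  show "(scale_fun c a has_real_derivative exp lam / c * (\<integral>\<omega>. kern_deriv c a (K \<omega>) (d (S \<omega>)) (x - S \<omega>) \<partial>M)) (at x within A)"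
    unfolding scale_fun_def[abs_def] by (rule DERIV_cmult[OF *(2)])
qed

text \<open>\<open>I\<close> is the closed or the open half-line, according to the side. The
  condition that \<open>x\<close> belongs to \<open>I\<close> makes the jump-free paths count, since
  there \<open>S\<close> is 0.\<close>

lemma scale_fun_one_sided_derivative:
  assumes "c > 0" "q \<ge> 0" and A: "x \<in> A" "\<And>y. y \<in> A \<Longrightarrow> y \<le> b" "b \<ge> 0" "at x within A \<noteq> bot"
    and d: "\<And>s. ((\<lambda>y. max (y - s) 0) has_real_derivative (indicator I (x - s))) (at x within A)"
    and I: "I \<in> sets borel" "{0<..} \<subseteq> I" "I \<subseteq> {0..}" "x \<in> I"
  defines "F \<equiv> \<lambda>\<omega>. deriv_integrand c lam q (x + c - S \<omega>) (K \<omega>) * indicator I (x - S \<omega>)"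
  shows "integrable M F \<and> (scale_fun c (q + lam) has_real_derivative exp (- q) / c\<^sup>2 * (\<integral>\<omega>. F \<omega> \<partial>M)) (at x within A)"
proof -
  let ?D = "\<lambda>\<omega>. kern_deriv c (q + lam) (K \<omega>) (indicator I (x - S \<omega>)) (x - S \<omega>)"
  have eq: "?D \<omega> = exp (- (q + lam)) / c * F \<omega>" for \<omega>
  proof -
    have "x - S \<omega> \<in> I" if "K \<omega> = 0" using S_zero[OF that] I by simp
    moreover have "x - S \<omega> \<ge> 0" if "x - S \<omega> \<in> I" using that I by auto
    moreover have "x - S \<omega> \<le> 0" if "x - S \<omega> \<notin> I" using that I by (meson greaterThan_iff not_le subsetD)
    moreover have "x + c - S \<omega> = x - S \<omega> + c" by simp
    ultimately show ?thesis unfolding F_def indicator_def of_bool_def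
      using kern_deriv_eq_deriv_integrand[OF \<open>c > 0\<close>, where P = "x - S \<omega> \<in> I" and u = "x - S \<omega>"] by presburger
  qed
  have a: "q + lam \<ge> 0" using \<open>q \<ge> 0\<close> lam_pos by simp
  have m: "(\<lambda>s. indicator I (x - s) :: real) \<in> borel_measurable borel" using I(1) by measurable
  note * = scale_fun_has_derivative[OF \<open>c > 0\<close> a A d m, unfolded eq]
  have "integrable M (\<lambda>\<omega>. c * exp (q + lam) * (exp (- (q + lam)) / c * F \<omega>))"
    using *(1) by (rule integrable_mult_right)
  then have int: "integrable M F" using \<open>c > 0\<close> by (simp add: exp_minus)
  \<comment> \<open>The constant of the theorem appears: \<open>exp lam\<close> meets
    \<open>exp (- (q + lam))\<close>, and one factor 1/c comes from \<open>scale_fun\<close>, the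
    other from the derivative of the kernel.\<close>
  have "exp lam / c * (\<integral>\<omega>. exp (- (q + lam)) / c * F \<omega> \<partial>M) = exp (- q) / c\<^sup>2 * (\<integral>\<omega>. F \<omega> \<partial>M)"
    using \<open>c > 0\<close> by (simp add: power2_eq_square exp_diff exp_minus divide_simps)
  with * int show ?thesis by simp
qed

lemma scale_fun_right_derivative:
  assumes "c > 0" "q \<ge> 0" "x \<ge> 0"
  defines "F \<equiv> \<lambda>\<omega>. deriv_integrand c lam q (x + c - S \<omega>) (K \<omega>) * indicator {0..} (x - S \<omega>)"
  shows "integrable M F \<and> (scale_fun c (q + lam) has_real_derivative exp (- q) / c\<^sup>2 * (\<integral>\<omega>. F \<omega> \<partial>M)) (at_right x)"
proof -
  \<comment> \<open>The length 1 is arbitrary; the interval has only to be bounded above and to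
    generate \<open>at_right x\<close>.\<close>
  have "((\<lambda>y. max (y - s) 0) has_real_derivative (indicator {0..} (x - s))) (at x within {x..x + 1})" for s
  proof -
    have "(indicator {0..} (x - s) :: real) = (if s \<le> x then 1 else 0)" by (simp add: indicator_def)
    then show ?thesis using max_has_right_derivative[of x "x + 1" s] by simp
  qed
  from scale_fun_one_sided_derivative[OF assms(1,2) _ _ _ _ this, of "x + 1"]
  show ?thesis using \<open>x \<ge> 0\<close> unfolding F_def by (force simp: at_within_Icc_at_right)
qed

lemma scale_fun_left_derivative:
  assumes "c > 0" "q \<ge> 0" "x > 0"
  defines "F \<equiv> \<lambda>\<omega>. deriv_integrand c lam q (x + c - S \<omega>) (K \<omega>) * indicator {0<..} (x - S \<omega>)"
  shows "integrable M F \<and> (scale_fun c (q + lam) has_real_derivative exp (- q) / c\<^sup>2 * (\<integral>\<omega>. F \<omega> \<partial>M)) (at_left x)"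
proof -
  have "((\<lambda>y. max (y - s) 0) has_real_derivative (indicator {0<..} (x - s))) (at x within {0..x})" for s
  proof -
    have "(indicator {0<..} (x - s) :: real) = (if s < x then 1 else 0)" by (simp add: indicator_def)
    then show ?thesis using max_has_left_derivative[of 0 x s] \<open>x > 0\<close> by simp
  qed
  from scale_fun_one_sided_derivative[OF assms(1,2) _ _ _ _ this, of x]
  show ?thesis using \<open>x > 0\<close> unfolding F_def by (simp add: at_within_Icc_at_left subset_eq)
qed

text \<open>A one-sided derivative forces continuity from that side; at 0 only the right side lies
  in the domain.\<close>

lemma continuous_on_scale_fun:
  assumes "c > 0" "q \<ge> 0"
  shows "continuous_on {0..} (scale_fun c (q + lam))"
  unfolding continuous_on_eq_continuous_within
proof
  fix x :: real assume "x \<in> {0..}"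
  then have "x \<ge> 0" by simp
  have r: "continuous (at_right x) (scale_fun c (q + lam))"
    using scale_fun_right_derivative[OF assms \<open>x \<ge> 0\<close>] by (meson has_field_derivative_imp_has_derivative has_derivative_continuous)
  show "continuous (at x within {0..}) (scale_fun c (q + lam))"
  proof (cases "x = 0")
    case True
    then show ?thesis using r by (simp add: at_within_Ici_at_right)
  next
    case False
    then have "x > 0" using \<open>x \<ge> 0\<close> by simp
    then have "continuous (at_left x) (scale_fun c (q + lam))"
      using scale_fun_left_derivative[OF assms] by (meson has_field_derivative_imp_has_derivative has_derivative_continuous)
    with r have "isCont (scale_fun c (q + lam)) x" by (simp add: continuous_at_split)
    then show ?thesis by (rule continuous_at_imp_continuous_at_within)
  qed
qed

section \<open>Laplace transform and primitive of the candidate\<close>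

lemma kern_pair_measurable:
  "(\<lambda>z. kern c a (K (fst z)) (snd z - S (fst z))) \<in> borel_measurable (M \<Otimes>\<^sub>M lborel)"
  by (rule measurable_compose_countable[of "\<lambda>n z. kern c a n (snd z - S (fst z))"]) simp_all

text \<open>By Fubini the transform is a sum over the values n of \<open>K\<close>. With e = b - a/c
  the n-th term is exp(-lam)/e times the n-th power of -lam p(b)/(c e). The assumption on
  \<open>b\<close> says c e > lam, so the series converges even with p(b) replaced by 1, and its sum
  times exp(lam)/c is 1/(c e + lam p(b)).\<close>

lemma scale_fun_laplace:
  assumes "c > 0" "a \<ge> 0" "c * b > a + lam"
  shows "set_integrable lborel {0..} (\<lambda>x. exp (- b * x) * scale_fun c a x)"
    and "(LINT x:{0..}|lborel. exp (- b * x) * scale_fun c a x) = 1 / (c * b - a + lam * p b)"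
proof -
  have "c * b > 0" using assms lam_pos by linarith
  then have b0: "b \<ge> 0" using \<open>c > 0\<close> by (simp add: zero_less_mult_iff)
  have ba: "b > a / c" using assms lam_pos by (simp add: field_simps)
  define e where "e = b - a / c"
  have e: "e > 0" "c * e > lam" using ba assms by (auto simp: e_def right_diff_distrib)
  interpret pair_sigma_finite M lborel by standard
  define f where "f \<omega> x = indicator {0..} x * (exp (- b * x) * kern c a (K \<omega>) (x - S \<omega>))" for \<omega> and x :: real
  \<comment> \<open>Here \<open>s\<close> is a sign: times \<open>exp (- b * S \<omega>)\<close>,
    the value at -1 is the Laplace integral of the kernel on K = n, and the value at 1 that of its
    modulus. The factorial will cancel against the Poisson weight.\<close>
  define h where "h s n = (s / c) ^ n * fact n / e ^ (n + 1)" for s :: real and n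
  have h: "summable (\<lambda>n. \<bar>h s n\<bar> * lam ^ n / fact n)" if "\<bar>s\<bar> = 1" for s
  proof -
    have "summable (\<lambda>n. 1 / e * (lam / (c * e)) ^ n)"
      using e lam_pos \<open>c > 0\<close> by (intro summable_mult summable_geometric) auto
    moreover have "\<bar>h s n\<bar> * lam ^ n / fact n = 1 / e * (lam / (c * e)) ^ n" for n
      unfolding h_def using e \<open>c > 0\<close> that by (simp add: abs_mult power_abs power_divide power_mult_distrib)
    ultimately show ?thesis by (simp only:)
  qed
  have fm[measurable]: "case_prod f \<in> borel_measurable (M \<Otimes>\<^sub>M lborel)"
    unfolding f_def split_beta' using kern_pair_measurable[measurable] by measurable
  have AEs: "AE \<omega> in M. S \<omega> \<ge> 0 \<and> (K \<omega> = 0 \<longrightarrow> S \<omega> = 0)"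
    using S_nonneg by eventually_elim (use S_zero in auto)
  have inner: "AE \<omega> in M. has_bochner_integral lborel (f \<omega>) (exp (- b * S \<omega>) * h (- 1) (K \<omega>))"
    using AEs
  proof eventually_elim
    case (elim \<omega>)
    then show ?case using has_bochner_integral_kern_laplace(1)[OF \<open>c > 0\<close> ba, of "S \<omega>" "K \<omega>"]
      unfolding f_def[abs_def] h_def e_def by (simp add: mult.assoc)
  qed
  have inner_abs: "AE \<omega> in M. has_bochner_integral lborel (\<lambda>x. norm (f \<omega> x)) (exp (- b * S \<omega>) * h 1 (K \<omega>))"
    using AEs
  proof eventually_elim
    case (elim \<omega>)
    then show ?case using has_bochner_integral_kern_laplace(2)[OF \<open>c > 0\<close> ba, of "S \<omega>" "K \<omega>"]
      unfolding f_def[abs_def] h_def e_def by (simp add: mult.assoc)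
  qed
  have fint: "integrable (M \<Otimes>\<^sub>M lborel) (case_prod f)"
  proof (rule Fubini_integrable)
    show "integrable M (\<lambda>\<omega>. \<integral>x. norm (case_prod f (\<omega>, x)) \<partial>lborel)"
    proof (rule integrable_cong_AE_imp)
      show "integrable M (\<lambda>\<omega>. exp (- b * S \<omega>) * h 1 (K \<omega>))"
        using expectation_laplace_K(1)[OF b0 h] by simp
      show "AE \<omega> in M. exp (- b * S \<omega>) * h 1 (K \<omega>) = (\<integral>x. norm (case_prod f (\<omega>, x)) \<partial>lborel)"
        using inner_abs by eventually_elim (auto simp: has_bochner_integral_iff)
    qed measurable
    show "AE \<omega> in M. integrable lborel (\<lambda>x. case_prod f (\<omega>, x))"
      using inner by eventually_elim (auto simp: has_bochner_integral_iff)
  qed measurable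
  have eV: "indicator {0..} x *\<^sub>R (exp (- b * x) * scale_fun c a x) = exp lam / c * (\<integral>\<omega>. f \<omega> x \<partial>M)" for x
    unfolding f_def scale_fun_def by simp
  show "set_integrable lborel {0..} (\<lambda>x. exp (- b * x) * scale_fun c a x)"
    unfolding set_integrable_def eV using integrable_snd[OF fint] by simp
  have "(LINT x:{0..}|lborel. exp (- b * x) * scale_fun c a x) = exp lam / c * (\<integral>x. (\<integral>\<omega>. f \<omega> x \<partial>M) \<partial>lborel)"
    unfolding set_lebesgue_integral_def eV by simp
  also have "(\<integral>x. (\<integral>\<omega>. f \<omega> x \<partial>M) \<partial>lborel) = (\<integral>\<omega>. (\<integral>x. f \<omega> x \<partial>lborel) \<partial>M)"
    by (rule Fubini_integral[OF fint])
  also have "\<dots> = (\<integral>\<omega>. exp (- b * S \<omega>) * h (- 1) (K \<omega>) \<partial>M)"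
  proof (rule integral_cong_AE)
    show "(\<lambda>\<omega>. exp (- b * S \<omega>) * h (- 1) (K \<omega>)) \<in> borel_measurable M"
      using expectation_laplace_K(1)[OF b0 h, of "- 1"] by simp
    show "AE \<omega> in M. integral\<^sup>L lborel (f \<omega>) = exp (- b * S \<omega>) * h (- 1) (K \<omega>)"
      using inner by eventually_elim (auto simp: has_bochner_integral_iff)
  qed measurable
  also have "\<dots> = (\<Sum>n. h (- 1) n * (lam ^ n / fact n * exp (- lam) * p b ^ n))"
    using expectation_laplace_K(2)[OF b0 h, of "- 1"] by simp
  also have "\<dots> = (\<Sum>n. exp (- lam) / e * (- (lam * p b / (c * e))) ^ n)"
    unfolding h_def by (intro suminf_cong) (simp add: power_divide power_mult_distrib power_minus' field_simps)
  also have "\<dots> = exp (- lam) / e * (1 / (1 - (- (lam * p b / (c * e)))))"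
  proof -
    have "lam * p b \<le> lam" using p_bounds[OF b0] lam_pos by simp
    then have "lam * p b < c * e" using e by linarith
    then have "\<bar>lam * p b / (c * e)\<bar> < 1"
      using e p_bounds[OF b0] lam_pos \<open>c > 0\<close> by (simp add: abs_mult)
    then show ?thesis by (subst suminf_mult) (auto intro!: summable_geometric simp: suminf_geometric)
  qed
  finally have *: "(LINT x:{0..}|lborel. exp (- b * x) * scale_fun c a x)
      = exp lam / c * (exp (- lam) / e * (1 / (1 - (- (lam * p b / (c * e))))))" .
  have nz: "c * e + lam * p b > 0" using e lam_pos p_bounds[OF b0] by (simp add: add_pos_nonneg)
  have "1 + lam * p b / (c * e) = (c * e + lam * p b) / (c * e)" using e \<open>c > 0\<close> by (simp add: field_simps)
  then have "exp lam / c * (exp (- lam) / e * (1 / (1 - (- (lam * p b / (c * e)))))) = 1 / (c * e + lam * p b)"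
    using e \<open>c > 0\<close> nz by (simp add: exp_minus)
  moreover have "c * e = c * b - a" using \<open>c > 0\<close> by (simp add: e_def field_simps)
  ultimately show "(LINT x:{0..}|lborel. exp (- b * x) * scale_fun c a x) = 1 / (c * b - a + lam * p b)"
    using * by metis
qed

text \<open>Fubini moves the integral inside the expectation, where \<open>integral_kern\<close>
  evaluates it path by path; the factor \<open>c\<close> gained there cancels the 1/c of
  \<open>scale_fun\<close>. The bound \<open>x * G \<omega>\<close> on the inner integral of the
  modulus provides integrability.\<close>

lemma integral_scale_fun:
  assumes "c > 0" "a \<ge> 0" "x \<ge> 0"
  defines "F \<equiv> \<lambda>\<omega>. (LINT y:{0..(x - S \<omega>) / c}|lborel. exp (a * y) * (- y) ^ K \<omega>) * indicator {0<..} (x - S \<omega>)"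
  shows "integrable M F \<and> (LINT y:{0..x}|lborel. scale_fun c a y) = exp lam * (\<integral>\<omega>. F \<omega> \<partial>M)"
proof -
  interpret pair_sigma_finite M lborel by standard
  define f where "f \<omega> y = indicator {0..x} y * kern c a (K \<omega>) (y - S \<omega>)" for \<omega> and y :: real
  define G where "G \<omega> = (x / c) ^ K \<omega> * exp (a / c * x)" for \<omega>
  have Gint: "integrable M G" unfolding G_def by (intro integrable_mult_left integrable_power_K)
  have fm[measurable]: "case_prod f \<in> borel_measurable (M \<Otimes>\<^sub>M lborel)"
    unfolding f_def split_beta' using kern_pair_measurable[measurable] by measurable
  have bnd: "AE \<omega> in M. \<forall>y. norm (f \<omega> y) \<le> indicator {0..x} y * G \<omega>"
    using S_nonneg
  proof eventually_elim
    case (elim \<omega>)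
    show ?case
    proof
      fix y
      show "norm (f \<omega> y) \<le> indicator {0..x} y * G \<omega>"
        using kern_bound[of c a "y - S \<omega>" x "K \<omega>"] assms elim
        unfolding f_def G_def by (auto simp: indicator_def)
    qed
  qed
  have cint: "integrable lborel (\<lambda>y. indicator {0..x} y * G \<omega>)" for \<omega> by (intro integrable_mult_left integrable_real_indicator) (auto simp: emeasure_lborel_Icc_eq)
  have inner: "AE \<omega> in M. integrable lborel (f \<omega>) \<and> (\<integral>y. norm (f \<omega> y) \<partial>lborel) \<le> x * G \<omega>"
    using bnd AE_space
  proof eventually_elim
    case (elim \<omega>)
    have [measurable]: "f \<omega> \<in> borel_measurable lborel" using elim(2) by measurable
    have i: "integrable lborel (f \<omega>)"
      by (rule Bochner_Integration.integrable_bound[OF cint[of \<omega>]]) (use elim in \<open>auto intro!: AE_I2 intro: order_trans[OF _ abs_ge_self]\<close>)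
    have "(\<integral>y. norm (f \<omega> y) \<partial>lborel) \<le> (\<integral>y. indicator {0..x} y * G \<omega> \<partial>lborel)"
      using elim by (intro integral_mono cint integrable_norm i) auto
    also have "\<dots> = x * G \<omega>" using \<open>x \<ge> 0\<close> by simp
    finally show ?case using i by simp
  qed
  have fint: "integrable (M \<Otimes>\<^sub>M lborel) (case_prod f)"
  proof (rule Fubini_integrable)
    show "integrable M (\<lambda>\<omega>. \<integral>y. norm (case_prod f (\<omega>, y)) \<partial>lborel)"
    proof (rule Bochner_Integration.integrable_bound)
      show "integrable M (\<lambda>\<omega>. x * G \<omega>)" using Gint by (rule integrable_mult_right)
      show "AE \<omega> in M. norm (\<integral>y. norm (case_prod f (\<omega>, y)) \<partial>lborel) \<le> norm (x * G \<omega>)"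
        using inner by eventually_elim (auto intro: order_trans[OF _ abs_ge_self])
    qed measurable
    show "AE \<omega> in M. integrable lborel (\<lambda>y. case_prod f (\<omega>, y))"
      using inner by eventually_elim simp
  qed measurable
  have J: "AE \<omega> in M. (\<integral>y. f \<omega> y \<partial>lborel) = c * F \<omega>"
    using S_nonneg
  proof eventually_elim
    case (elim \<omega>)
    then show ?case using integral_kern[OF \<open>c > 0\<close>, of "S \<omega>" "K \<omega>" x a] S_zero[of \<omega>]
      unfolding f_def F_def set_lebesgue_integral_def by simp
  qed
  have Fmeas: "F \<in> borel_measurable M"
    unfolding F_def set_lebesgue_integral_def
  proof (rule measurable_K_family)
    fix n
    \<comment> \<open>The right endpoint depends on the path, so joint measurability is obtained by
      writing the indicator through two inequalities.\<close>
    have [measurable]: "(\<lambda>z. indicator {0..(x - S (fst z)) / c} (snd z) :: real) \<in> borel_measurable (M \<Otimes>\<^sub>M lborel)"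
    proof -
      have "(\<lambda>z. indicator {0..(x - S (fst z)) / c} (snd z) :: real)
        = (\<lambda>z. if 0 \<le> snd z \<and> snd z \<le> (x - S (fst z)) / c then 1 else 0)"
        by (auto simp: indicator_def)
      then show ?thesis by simp
    qed
    show "(\<lambda>\<omega>. (\<integral>y. indicator {0..(x - S \<omega>) / c} y *\<^sub>R (exp (a * y) * (- y) ^ n) \<partial>lborel)
        * indicator {0<..} (x - S \<omega>)) \<in> borel_measurable M"
      by measurable
  qed
  have "integrable M (\<lambda>\<omega>. \<integral>y. f \<omega> y \<partial>lborel)" using integrable_fst[OF fint] .
  then have "integrable M (\<lambda>\<omega>. c * F \<omega>)"
    by (rule integrable_cong_AE_imp) (use Fmeas J in auto)
  then have Fint: "integrable M F" using \<open>c > 0\<close> by simp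
  have eV: "indicator {0..x} y *\<^sub>R scale_fun c a y = exp lam / c * (\<integral>\<omega>. f \<omega> y \<partial>M)" for y
    unfolding f_def scale_fun_def by simp
  have "(LINT y:{0..x}|lborel. scale_fun c a y) = exp lam / c * (\<integral>y. (\<integral>\<omega>. f \<omega> y \<partial>M) \<partial>lborel)"
    unfolding set_lebesgue_integral_def eV by simp
  also have "(\<integral>y. (\<integral>\<omega>. f \<omega> y \<partial>M) \<partial>lborel) = (\<integral>\<omega>. (\<integral>y. f \<omega> y \<partial>lborel) \<partial>M)"
    by (rule Fubini_integral[OF fint])
  also have "\<dots> = (\<integral>\<omega>. c * F \<omega> \<partial>M)"
    by (rule integral_cong_AE) (use J Fmeas in measurable)
  finally show ?thesis using Fint \<open>c > 0\<close> by simp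
qed

end

section \<open>The compound Poisson process at time one\<close>

text \<open>Each member of the family is a coordinate of the map that generates the sigma-algebra of
  \<open>family_events\<close>.\<close>

lemma measurable_component_vimage_algebra:
  assumes "\<And>i. i \<in> I \<Longrightarrow> X i \<in> measurable M S" "j \<in> I"
  shows "X j \<in> measurable (vimage_algebra (space M) (\<lambda>\<omega>. \<lambda>i\<in>I. X i \<omega>) (PiM I (\<lambda>_. S))) S"
proof -
  have "(\<lambda>\<omega>. \<lambda>i\<in>I. X i \<omega>) \<in> space M \<rightarrow> space (PiM I (\<lambda>_. S))"
    by (intro Pi_I) (auto simp: space_PiM measurable_space[OF assms(1)])
  from measurable_compose[OF measurable_vimage_algebra1[OF this] measurable_component_singleton[OF \<open>j \<in> I\<close>]]
  show ?thesis using \<open>j \<in> I\<close> by simp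
qed

text \<open>Independence passes to the smaller sigma-algebras generated by \<open>Y\<close> and
  \<open>Z\<close>. As both are real-valued, the product formula for expectations becomes
  available.\<close>

lemma (in prob_space) indep_var_of_indep_set:
  fixes Y Z :: "'a \<Rightarrow> real"
  assumes indep: "indep_set (sets A) (sets B)" and sp: "space A = space M" "space B = space M"
    and Y: "Y \<in> borel_measurable A" and Z: "Z \<in> borel_measurable B"
  shows "indep_var borel Y borel Z"
proof -
  have sub: "sets A \<subseteq> events" "sets B \<subseteq> events"
    using indep_setD_ev1[OF indep] indep_setD_ev2[OF indep] by auto
  have s: "sigma_sets (space M) {X -` C \<inter> space M | C. C \<in> sets borel} \<subseteq> sets D"
    if "X \<in> borel_measurable D" "space D = space M" for D and X :: "'a \<Rightarrow> real"
    using sets.sigma_sets_subset[of "{X -` C \<inter> space M | C. C \<in> sets borel}" D] measurable_sets[OF that(1)] that(2)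
    by auto
  have "Y \<in> borel_measurable M" "Z \<in> borel_measurable M"
    using Y Z sub sp by (auto simp: measurable_def)
  moreover have "indep_set (sigma_sets (space M) {Y -` C \<inter> space M | C. C \<in> sets borel})
      (sigma_sets (space M) {Z -` C \<inter> space M | C. C \<in> sets borel})"
    using indep unfolding indep_set_def
    by (rule indep_sets_mono_sets) (use s[OF Y sp(1)] s[OF Z sp(2)] in \<open>auto split: bool.split\<close>)
  ultimately show ?thesis unfolding indep_var_eq by simp
qed

definition jump_laplace :: "real measure \<Rightarrow> real \<Rightarrow> real" where
  "jump_laplace R b = (\<integral>x. exp (- b * x) \<partial>R)"

text \<open>The substantial point is \<open>S_laplace\<close>: on N_1 = n the random sum has exactly
  n terms, so the integrand is an indicator determined by \<open>N\<close> times a product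
  determined by \<open>xi\<close>. Independence of the families separates the two, and the i.i.d.
  jumps turn the product into an n-th power.\<close>

lemma poisson_sum_cpp:
  fixes N :: "real \<Rightarrow> 'a \<Rightarrow> nat" and xi :: "nat \<Rightarrow> 'a \<Rightarrow> real" and Pi :: "real measure"
  assumes "prob_space M" and "lam > 0"
    and "prob_space Pi" and sets_Pi: "sets Pi = sets borel" and "measure Pi {0<..} = 1"
    and N: "poisson_process M lam N"
    and indep_xi: "prob_space.indep_vars M (\<lambda>_. borel) xi {1..}"
    and distr_xi: "\<And>i. i \<ge> 1 \<Longrightarrow> distr M borel (xi i) = Pi"
    and indep: "prob_space.indep_set M
           (family_events M {0..} (count_space UNIV) N) (family_events M {1..} borel xi)"
  shows "poisson_sum M (N 1) (\<lambda>\<omega>. \<Sum>i = 1..N 1 \<omega>. xi i \<omega>) lam (jump_laplace Pi)"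
proof -
  interpret prob_space M by fact
  interpret Pi: prob_space Pi by fact
  have N_meas: "N t \<in> measurable M (count_space UNIV)" if "t \<ge> 0" for t
    using N that unfolding poisson_process_def by blast
  have [measurable]: "N 1 \<in> measurable M (count_space UNIV)" by (rule N_meas) simp
  have xi_meas[measurable]: "xi i \<in> borel_measurable M" if "i \<ge> 1" for i
    using indep_xi that unfolding indep_vars_def by auto
  have S_meas: "(\<lambda>\<omega>. \<Sum>i = 1..N 1 \<omega>. xi i \<omega>) \<in> borel_measurable M"
    by (rule measurable_compose_countable[of "\<lambda>n \<omega>. \<Sum>i = 1..n. xi i \<omega>"]) auto
  have N_distr: "distr M (count_space UNIV) (N 1) = measure_pmf (poisson_pmf lam)"
  proof -
    \<comment> \<open>Only increments have a prescribed law, so the law of N_1 is read off from the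
      increment over [0,1].\<close>
    have "AE \<omega> in M. N 0 \<omega> = 0" using N unfolding poisson_process_def by auto
    then have "AE \<omega> in M. N 1 \<omega> = N 1 \<omega> - N 0 \<omega>" by eventually_elim simp
    moreover have "(\<lambda>\<omega>. N 1 \<omega> - N 0 \<omega>) \<in> measurable M (count_space UNIV)"
      using N_meas[of 0] N_meas[of 1] by measurable
    ultimately have "distr M (count_space UNIV) (N 1) = distr M (count_space UNIV) (\<lambda>\<omega>. N 1 \<omega> - N 0 \<omega>)"
      by (intro distr_cong_AE) auto
    also have "\<dots> = measure_pmf (poisson_pmf (lam * (1 - 0)))"
      using N unfolding poisson_process_def by (meson order_refl zero_less_one)
    finally show ?thesis by simp
  qed
  have Pi_pos: "AE x in Pi. x > 0"
    using Pi.AE_in_set_eq_1[of "{0<..}"] assms by (simp add: sets_Pi)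
  have xi_pos: "AE \<omega> in M. \<forall>i\<in>{1..}. xi i \<omega> > 0"
  proof (rule AE_ball_countable[THEN iffD2], simp, intro ballI)
    fix i :: nat assume i: "i \<in> {1..}"
    then have "AE x in distr M borel (xi i). x > 0" by (subst distr_xi) (use Pi_pos in auto)
    then show "AE \<omega> in M. xi i \<omega> > 0" using i by (subst (asm) AE_distr_iff) auto
  qed
  have exp_int: "integrable Pi (\<lambda>x. exp (- b * x))" "AE x in Pi. exp (- b * x) \<le> 1" if "b \<ge> 0" for b
  proof -
    show le: "AE x in Pi. exp (- b * x) \<le> 1" using Pi_pos by eventually_elim (use that in simp)
    then have bd: "AE x in Pi. norm (exp (- b * x)) \<le> 1" by simp
    show "integrable Pi (\<lambda>x. exp (- b * x))"
      by (rule Pi.integrable_const_bound[OF bd]) (simp add: measurable_cong_sets[OF sets_Pi refl])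
  qed
  have xi_laplace: "integrable M (\<lambda>\<omega>. exp (- b * xi i \<omega>))"
    "(\<integral>\<omega>. exp (- b * xi i \<omega>) \<partial>M) = jump_laplace Pi b" if "b \<ge> 0" "i \<ge> 1" for b i
  proof -
    note [measurable] = xi_meas[OF \<open>i \<ge> 1\<close>]
    show "integrable M (\<lambda>\<omega>. exp (- b * xi i \<omega>))"
      using exp_int(1)[OF \<open>b \<ge> 0\<close>] unfolding distr_xi[OF \<open>i \<ge> 1\<close>, symmetric]
      by (subst (asm) integrable_distr_eq) auto
    show "(\<integral>\<omega>. exp (- b * xi i \<omega>) \<partial>M) = jump_laplace Pi b"
      unfolding jump_laplace_def distr_xi[OF \<open>i \<ge> 1\<close>, symmetric] by (subst integral_distr) auto
  qed
  have S_laplace: "(\<integral>\<omega>. indicator {n} (N 1 \<omega>) * exp (- b * (\<Sum>i = 1..N 1 \<omega>. xi i \<omega>)) \<partial>M)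
      = lam ^ n / fact n * exp (- lam) * jump_laplace Pi b ^ n" if "b \<ge> 0" for b n
  proof -
    \<comment> \<open>In \<open>?Z\<close> the random upper limit is frozen at \<open>n\<close>,
      which makes it a function of the jumps alone; multiplied by \<open>?Y\<close> it agrees with
      the original integrand.\<close>
    let ?Y = "\<lambda>\<omega>. indicator {n} (N 1 \<omega>) :: real" and ?Z = "\<lambda>\<omega>. \<Prod>i\<in>{1..n}. exp (- b * xi i \<omega>)"
    have iv: "indep_vars (\<lambda>_. borel) (\<lambda>i \<omega>. exp (- b * xi i \<omega>)) {1..n}"
      by (rule indep_vars_compose2[where M' = "\<lambda>_. borel" and Y = "\<lambda>i x. exp (- b * x)"])
        (use indep_vars_subset[OF indep_xi, of "{1..n}"] in auto)
    have Zint: "integrable M ?Z"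
      by (rule indep_vars_integrable[OF _ iv]) (use xi_laplace \<open>b \<ge> 0\<close> in auto)
    have Z: "(\<integral>\<omega>. ?Z \<omega> \<partial>M) = jump_laplace Pi b ^ n"
      by (subst indep_vars_lebesgue_integral[OF _ iv]) (use xi_laplace \<open>b \<ge> 0\<close> in auto)
    have [measurable]: "?Y \<in> borel_measurable M"
      by (rule measurable_compose[of "N 1" M "count_space UNIV"]) simp_all
    have Yint: "integrable M ?Y" by (rule integrable_const_bound[where B = 1]) auto
    have "(\<integral>\<omega>. ?Y \<omega> \<partial>M) = (\<integral>k. indicator {n} k \<partial>(distr M (count_space UNIV) (N 1)))"
      by (subst integral_distr) auto
    also have "\<dots> = lam ^ n / fact n * exp (- lam)"
      unfolding N_distr using \<open>lam > 0\<close> by (simp add: measure_pmf_single)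
    finally have Y: "(\<integral>\<omega>. ?Y \<omega> \<partial>M) = lam ^ n / fact n * exp (- lam)" .
    have "indep_var borel ?Y borel ?Z"
    proof (rule indep_var_of_indep_set[OF indep[unfolded family_events_def]])
      show "?Y \<in> borel_measurable (vimage_algebra (space M) (\<lambda>\<omega>. \<lambda>i\<in>{0..}. N i \<omega>) (PiM {0..} (\<lambda>_. count_space UNIV)))"
        by (rule measurable_compose[OF measurable_component_vimage_algebra]) (use N_meas in auto)
      have "xi i \<in> borel_measurable (vimage_algebra (space M) (\<lambda>\<omega>. \<lambda>i\<in>{1..}. xi i \<omega>) (PiM {1..} (\<lambda>_. borel)))"
        if "i \<in> {1..n}" for i
        by (rule measurable_component_vimage_algebra) (use xi_meas that in auto)
      then show "?Z \<in> borel_measurable (vimage_algebra (space M) (\<lambda>\<omega>. \<lambda>i\<in>{1..}. xi i \<omega>) (PiM {1..} (\<lambda>_. borel)))"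
        by (intro borel_measurable_prod measurable_compose[OF _ borel_measurable_exp] borel_measurable_times borel_measurable_const)
    qed auto
    from indep_var_lebesgue_integral[OF this Yint Zint]
    have "(\<integral>\<omega>. ?Y \<omega> * ?Z \<omega> \<partial>M) = lam ^ n / fact n * exp (- lam) * jump_laplace Pi b ^ n"
      using Y Z by simp
    moreover have "?Y \<omega> * ?Z \<omega> = indicator {n} (N 1 \<omega>) * exp (- b * (\<Sum>i = 1..N 1 \<omega>. xi i \<omega>))" for \<omega>
      by (auto simp: indicator_def exp_sum[symmetric] sum_distrib_left)
    ultimately show ?thesis by (simp only:)
  qed
  show ?thesis
  proof unfold_locales
    show "AE \<omega> in M. (\<Sum>i = 1..N 1 \<omega>. xi i \<omega>) \<ge> 0"
      using xi_pos by eventually_elim (rule sum_nonneg, simp add: less_imp_le)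
    show "0 \<le> jump_laplace Pi b" for b unfolding jump_laplace_def by (rule integral_nonneg_AE) simp
    show "jump_laplace Pi b \<le> 1" if "b \<ge> 0" for b
      unfolding jump_laplace_def using exp_int[OF that] by (intro Pi.integral_le_const) auto
  qed (use \<open>lam > 0\<close> S_meas N_distr S_laplace in auto)
qed

text \<open>The constant function 1 in \<open>expectation_laplace_K\<close> leaves an exponential
  series. The result yields the closed form of the Laplace exponent.\<close>

lemma (in poisson_sum) expectation_exp_S:
  assumes "b \<ge> 0"
  shows "(\<integral>\<omega>. exp (- b * S \<omega>) \<partial>M) = exp (lam * p b - lam)"
proof -
  have "summable (\<lambda>n. \<bar>1::real\<bar> * lam ^ n / fact n)"
    using summable_exp[of lam] by (simp add: field_simps)
  from expectation_laplace_K(2)[OF assms this]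
  have "(\<integral>\<omega>. exp (- b * S \<omega>) \<partial>M) = (\<Sum>n. lam ^ n / fact n * exp (- lam) * p b ^ n)" by simp
  also have "\<dots> = (\<Sum>n. exp (- lam) * ((lam * p b) ^ n /\<^sub>R fact n))"
    by (intro suminf_cong) (simp add: power_mult_distrib field_simps)
  also have "\<dots> = exp (- lam) * exp (lam * p b)"
    unfolding exp_def[THEN fun_cong, of "lam * p b"] by (intro suminf_mult summable_exp_generic)
  finally show ?thesis by (simp add: mult_exp_exp)
qed

section \<open>Identification of the scale function and transfer of the three formulas\<close>

theorem corollary4p7:
  fixes M :: "'a measure"
    and N :: "real \<Rightarrow> 'a \<Rightarrow> nat"
    and xi :: "nat \<Rightarrow> 'a \<Rightarrow> real"
    and Pi :: "real measure"
    and c lam q :: real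
    and W :: "real \<Rightarrow> real"
  assumes "prob_space M"
    and "c > 0" and "lam > 0" and "q \<ge> 0"
    and "prob_space Pi" and "sets Pi = sets borel" and "measure Pi {0<..} = 1"
    and "poisson_process M lam N"
    and "prob_space.indep_vars M (\<lambda>_. borel) xi {1..}"
    and "\<And>i. i \<ge> 1 \<Longrightarrow> distr M borel (xi i) = Pi"
    and "prob_space.indep_set M
           (family_events M {0..} (count_space UNIV) N) (family_events M {1..} borel xi)"
    and "is_scale_function (laplace_exponent M c N xi) q W"
  shows
    "(\<forall>x\<ge>0. let F = (\<lambda>\<omega>. deriv_integrand c lam q (cpp_path c N xi x 1 \<omega>) (N 1 \<omega>)
                          * indicator {c..} (cpp_path c N xi x 1 \<omega>))
       in integrable M F \<and>
          (W has_real_derivative exp (- q) / c\<^sup>2 * (\<integral>\<omega>. F \<omega> \<partial>M)) (at_right x))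
   \<and> (\<forall>x>0. let F = (\<lambda>\<omega>. deriv_integrand c lam q (cpp_path c N xi x 1 \<omega>) (N 1 \<omega>)
                          * indicator {c<..} (cpp_path c N xi x 1 \<omega>))
       in integrable M F \<and>
          (W has_real_derivative exp (- q) / c\<^sup>2 * (\<integral>\<omega>. F \<omega> \<partial>M)) (at_left x))
   \<and> (\<forall>x\<ge>0. let F = (\<lambda>\<omega>. (LINT y:{0..cpp_path c N xi x 1 \<omega> / c - 1}|lborel.
                              exp ((q + lam) * y) * (- y) ^ N 1 \<omega>)
                          * indicator {c<..} (cpp_path c N xi x 1 \<omega>))
       in integrable M F \<and>
          (LINT y:{0..x}|lborel. W y) = exp lam * (\<integral>\<omega>. F \<omega> \<partial>M))"
proof -
  define S where "S \<omega> = (\<Sum>i = 1..N 1 \<omega>. xi i \<omega>)" for \<omega>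
  define \<psi> where "\<psi> = laplace_exponent M c N xi"
  let ?p = "jump_laplace Pi"
  interpret poisson_sum M "N 1" S lam ?p
    unfolding S_def[abs_def] by (rule poisson_sum_cpp) fact+
  have a: "q + lam \<ge> 0" using assms(3,4) by simp
  have L: "cpp_path c N xi x 1 \<omega> = x + c - S \<omega>" for x \<omega>
    by (simp add: cpp_path_def S_def)
  \<comment> \<open>Subtracting \<open>q\<close> gives exactly the denominator in
    \<open>scale_fun_laplace\<close> for a = q + lam.\<close>
  have \<psi>: "\<psi> b = c * b - lam + lam * ?p b" if "b \<ge> 0" for b
  proof -
    have "exp (b * cpp_path c N xi 0 1 \<omega>) = exp (b * c) * exp (- b * S \<omega>)" for \<omega>
      unfolding L by (simp add: exp_add[symmetric] algebra_simps)
    then have "(\<integral>\<omega>. exp (b * cpp_path c N xi 0 1 \<omega>) \<partial>M) = exp (b * c) * exp (lam * ?p b - lam)"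
      by (simp only: integral_mult_right_zero expectation_exp_S[OF that])
    then show ?thesis unfolding \<psi>_def laplace_exponent_def by (simp add: exp_add[symmetric])
  qed
  have sc: "continuous_on {0..} W"
    "\<And>b. b > right_inverse \<psi> q \<Longrightarrow> set_integrable lborel {0..} (\<lambda>x. exp (- b * x) * W x)"
    "\<And>b. b > right_inverse \<psi> q \<Longrightarrow> (LINT x:{0..}|lborel. exp (- b * x) * W x) = 1 / (\<psi> b - q)"
    using assms(12) unfolding is_scale_function_def \<psi>_def by auto
  have WV: "W x = scale_fun c (q + lam) x" if "x \<ge> 0" for x
  proof (rule laplace_unique[OF sc(1) continuous_on_scale_fun[OF \<open>c > 0\<close> \<open>q \<ge> 0\<close>] _ _ _ that])
    \<comment> \<open>Beyond the first bound the transform of \<open>W\<close> is prescribed; beyond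
      the second the geometric series for the candidate converges.\<close>
    fix b assume b: "b > max (right_inverse \<psi> q) ((q + lam + lam) / c)"
    then have "c * b > q + lam + lam" using \<open>c > 0\<close> by (simp add: field_simps)
    note V = scale_fun_laplace[OF \<open>c > 0\<close> a this]
    have "(q + lam + lam) / c \<ge> 0" using assms(2-4) by simp
    then have "b \<ge> 0" using b by simp
    show "set_integrable lborel {0..} (\<lambda>x. exp (- b * x) * W x)" using b by (intro sc) simp
    show "set_integrable lborel {0..} (\<lambda>x. exp (- b * x) * scale_fun c (q + lam) x)" by (rule V)
    show "(LINT x:{0..}|lborel. exp (- b * x) * W x) = (LINT x:{0..}|lborel. exp (- b * x) * scale_fun c (q + lam) x)"
      using sc(3)[of b] b unfolding V(2) \<psi>[OF \<open>b \<ge> 0\<close>] by (simp add: algebra_simps)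
  qed
  have ind: "indicator {c..} (x + c - S \<omega>) = (indicator {0..} (x - S \<omega>) :: real)"
    "indicator {c<..} (x + c - S \<omega>) = (indicator {0<..} (x - S \<omega>) :: real)" for x \<omega>
    by (auto simp: indicator_def)
  have quot: "(x + c - S \<omega>) / c - 1 = (x - S \<omega>) / c" for x \<omega>
    using \<open>c > 0\<close> by (simp add: field_simps)
  \<comment> \<open>\<open>W\<close> equals the candidate only on the closed half-line. Points to
    the right of x >= 0, and points close to the left of x > 0, lie in it, so one-sided derivatives
    carry over.\<close>
  have right: "(W has_real_derivative D) (at_right x)"
    if "(scale_fun c (q + lam) has_real_derivative D) (at_right x)" "x \<ge> 0" for D x
  proof -
    have "\<forall>\<^sub>F y in at_right x. W y = scale_fun c (q + lam) y"
      using eventually_at_right_less[of x] by eventually_elim (use that WV in auto)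
    with that show ?thesis using WV[of x] by (subst has_field_derivative_cong_eventually) auto
  qed
  have left: "(W has_real_derivative D) (at_left x)"
    if "(scale_fun c (q + lam) has_real_derivative D) (at_left x)" "x > 0" for D x
  proof -
    have "\<forall>\<^sub>F y in at_left x. y > 0"
      using \<open>x > 0\<close> eventually_at_left by blast
    then have "\<forall>\<^sub>F y in at_left x. W y = scale_fun c (q + lam) y"
      by eventually_elim (use WV in auto)
    with that show ?thesis using WV[of x] by (subst has_field_derivative_cong_eventually) auto
  qed
  have int: "(LINT y:{0..x}|lborel. W y) = (LINT y:{0..x}|lborel. scale_fun c (q + lam) y)" for x
    by (intro set_lebesgue_integral_cong) (use WV in auto)
  show ?thesis
    unfolding L ind quot Let_def int
  proof (intro conjI allI impI)
    fix x :: real assume x: "x \<ge> 0"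
    note R = scale_fun_right_derivative[OF \<open>c > 0\<close> \<open>q \<ge> 0\<close> x]
    from R show "integrable M (\<lambda>\<omega>. deriv_integrand c lam q (x + c - S \<omega>) (N 1 \<omega>) * indicator {0..} (x - S \<omega>))"
      by (rule conjunct1)
    from R show "(W has_real_derivative exp (- q) / c\<^sup>2 *
        (\<integral>\<omega>. deriv_integrand c lam q (x + c - S \<omega>) (N 1 \<omega>) * indicator {0..} (x - S \<omega>) \<partial>M)) (at_right x)"
      by (intro right x) (rule conjunct2)
    note I = integral_scale_fun[OF \<open>c > 0\<close> a x]
    from I show "integrable M (\<lambda>\<omega>. (LINT y:{0..(x - S \<omega>) / c}|lborel. exp ((q + lam) * y) * (- y) ^ N 1 \<omega>)
        * indicator {0<..} (x - S \<omega>))" by (rule conjunct1)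
    from I show "(LINT y:{0..x}|lborel. scale_fun c (q + lam) y) = exp lam *
        (\<integral>\<omega>. (LINT y:{0..(x - S \<omega>) / c}|lborel. exp ((q + lam) * y) * (- y) ^ N 1 \<omega>)
          * indicator {0<..} (x - S \<omega>) \<partial>M)" by (rule conjunct2)
  next
    fix x :: real assume x: "x > 0"
    note R = scale_fun_left_derivative[OF \<open>c > 0\<close> \<open>q \<ge> 0\<close> x]
    from R show "integrable M (\<lambda>\<omega>. deriv_integrand c lam q (x + c - S \<omega>) (N 1 \<omega>) * indicator {0<..} (x - S \<omega>))"
      by (rule conjunct1)
    from R show "(W has_real_derivative exp (- q) / c\<^sup>2 *
        (\<integral>\<omega>. deriv_integrand c lam q (x + c - S \<omega>) (N 1 \<omega>) * indicator {0<..} (x - S \<omega>) \<partial>M)) (at_left x)"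
      by (intro left x) (rule conjunct2)
  qed
qed

end
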